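(* For all non-negative integers $a, b$, $$\xi(\{1\}^a, 2, \{1\}^b)+\xi(\{1\}^b,2,\{1\}^a) = -\frac{(-2\pi i)^{a+b+2}}{(a+b+3)!},$$ and $$\xi(\{2\}^a, 3, \{2\}^b)+\xi(\{2\}^b,3,\{2\}^a)=0.$$
   Context: For a positive integer $k$ and a complex number $q$, $[k]_q=1+q+\cdots+q^{k-1}$ (equal to $\frac{1-q^k}{1-q}$ for $q\neq 1$). For a positive integer $n$, a primitive $n$-th root of unity $\zeta_n\in\mathbb{C}$ and an $r$-tuple ${\bf s}=(s_1,\ldots,s_r)$ of positive integers, $$z_n({\bf s};\zeta_n)=\sum_{1\le k_1<\cdots<k_r\le n-1}\ \prod_{i=1}^r\frac{\zeta_n^{(s_i-1)k_i}}{[k_i]_{\zeta_n}^{s_i}},$$ where an empty sum is $0$. The complex number $\xi({\bf s})$ is defined as the limit $$\xi({\bf s})=\lim_{n\to\infty}z_n({\bf s};e^{2\pi i/n}),$$ which is known to exist (a theorem of Bachmann, Takeyama and Tasaka). The symbol $\{c\}^m$ denotes $m$ consecutive copies of the entry $c$ (nothing if $m=0$). *)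

theory Defs
  imports "HOL-Analysis.Analysis"
begin

definition q_number :: "complex \<Rightarrow> nat \<Rightarrow> complex" where
  "q_number q k = (\<Sum>j<k. q ^ j)"

(* The tuples 1 <= k_1 < ... < k_r <= n - 1. *)
definition increasing_tuples :: "nat \<Rightarrow> nat \<Rightarrow> nat list set" where
  "increasing_tuples r n =
     {ks. length ks = r \<and> sorted_wrt (<) ks \<and> set ks \<subseteq> {1..<n}}"

lemma finite_increasing_tuples: "finite (increasing_tuples r n)"
proof -
  have "finite {ks. set ks \<subseteq> {1..<n} \<and> length ks = r}"
    by (rule finite_lists_length_eq) simp
  then show ?thesis
    by (rule rev_finite_subset) (auto simp: increasing_tuples_def)
qed

(* The value z_n(s; zeta). It is meant for zeta a primitive n-th root of unity, so that
   no q_number in a denominator vanishes, and for s with positive entries, so that the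
   natural-number subtraction s_i - 1 does not truncate. List positions count from 0. *)
definition zn :: "nat \<Rightarrow> nat list \<Rightarrow> complex \<Rightarrow> complex" where
  "zn n s \<zeta> =
     (\<Sum>ks\<in>increasing_tuples (length s) n.
        \<Prod>i<length s. \<zeta> ^ ((s ! i - 1) * (ks ! i)) / q_number \<zeta> (ks ! i) ^ (s ! i))"

(* The limit exists for every s with positive entries (Bachmann, Takeyama and Tasaka). *)
definition xi :: "nat list \<Rightarrow> complex" where
  "xi s = lim (\<lambda>n. zn n s (exp (2 * of_real pi * \<i> / of_nat n)))"

end

theory Submission
  imports Defs "HOL-Computational_Algebra.Polynomial" "HOL-Real_Asymp.Real_Asymp"
begin

text \<open>
  Put \<open>q = exp(2 \<pi> i / n)\<close>, \<open>t = 1 - q\<close>, \<open>u\<^sub>j = 1 / [j]\<close> and \<open>v\<^sub>j = q\<^sup>j u\<^sub>j\<^sup>2\<close>.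

  Existence of the limits: \<open>z\<^sub>n\<close> is a sum over the position \<open>k\<close> of the exceptional entry, the other
  factors being elementary symmetric functions of the weights below and above \<open>k\<close>. For \<open>k < n/2\<close> the
  symmetric functions above \<open>k\<close> are controlled through those of the full range \<open>{1..<n}\<close>, which
  converge, and those below \<open>k\<close>, which grow like powers of \<open>log k\<close>; Tannery's theorem applies. The
  other half is reflected by \<open>k \<mapsto> n - k\<close>.

  First identity: let \<open>F x y = \<Sum>\<^sub>k \<Prod>\<^sub>j\<^sub><\<^sub>k (1 + x u\<^sub>j) v\<^sub>k \<Prod>\<^sub>j\<^sub>>\<^sub>k (1 + y u\<^sub>j)\<close>, a polynomial of degree
  at most \<open>n - 2\<close> in each variable. A telescoping sum shows that
  \<open>(1 - X) F\<close>, with \<open>X = 1 + x t\<close>, is invariant under \<open>X \<mapsto> q X\<close> at the \<open>n - 1\<close> zeros of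
  \<open>\<Prod>\<^sub>j (1 + x u\<^sub>j)\<close>, except for one jump on the diagonal. This gives \<open>F\<close> at all pairs of zeros, hence
  by interpolation \<open>F x y + F y x\<close>, whose coefficients are
  \<open>- t\<^sup>a\<^sup>+\<^sup>b\<^sup>+\<^sup>2 (n+1 choose a+b+3) / n\<close>, and \<open>n t \<longlonglongrightarrow> - 2 \<pi> i\<close>.

  Second identity: reflecting \<open>k \<mapsto> n - k\<close> shows that the symmetrized sum equals \<open>- t\<close> times a
  convergent sum.
\<close>

section \<open>Elementary symmetric functions\<close>

text \<open>Encoded as a coefficient so that disjoint unions of index sets become polynomial
  products and the generating functions below expand in \<open>esym\<close> directly.\<close>

definition esym :: "('i \<Rightarrow> 'a::comm_ring_1) \<Rightarrow> 'i set \<Rightarrow> nat \<Rightarrow> 'a" where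
  "esym f S m = coeff (\<Prod>j\<in>S. [:1, f j:]) m"

lemma esym_empty: "esym f {} m = (if m = 0 then 1 else 0)"
  by (simp add: esym_def)

lemma esym_0: "esym f S 0 = 1"
proof -
  have "poly (\<Prod>j\<in>S. [:1, f j:]) 0 = 1"
    by (simp add: poly_prod)
  then show ?thesis
    by (simp add: esym_def poly_0_coeff_0)
qed

lemma esym_insert_Suc:
  assumes "finite S" "x \<notin> S"
  shows "esym f (insert x S) (Suc m) = esym f S (Suc m) + f x * esym f S m"
  using assms by (simp add: esym_def)

lemma esym_union:
  assumes "finite S" "finite T" "S \<inter> T = {}"
  shows "esym f (S \<union> T) m = (\<Sum>i\<le>m. esym f S i * esym f T (m - i))"
  using assms by (simp add: esym_def prod.union_disjoint coeff_mult)

lemma esym_cong: "(\<And>j. j \<in> S \<Longrightarrow> f j = g j) \<Longrightarrow> esym f S m = esym g S m"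
  by (simp add: esym_def cong: prod.cong)

lemma esym_reindex:
  assumes "inj_on h S"
  shows "esym f (h ` S) m = esym (f \<circ> h) S m"
  using assms by (simp add: esym_def prod.reindex)

text \<open>Groups the monomials by their largest index \<open>k\<close>; \<open>zn_snoc\<close>
  gives tuples the same recursion.\<close>

lemma esym_Suc_interval:
  fixes f :: "nat \<Rightarrow> 'a::comm_ring_1"
  shows "esym f {l..<h} (Suc m) = (\<Sum>k\<in>{l..<h}. esym f {l..<k} m * f k)"
proof (induction h)
  case 0
  show ?case by (simp add: esym_empty)
next
  case (Suc h)
  show ?case
  proof (cases "l \<le> h")
    case True
    then have eq: "{l..<Suc h} = insert h {l..<h}"
      by auto
    show ?thesis
      using Suc unfolding eq by (simp add: esym_insert_Suc algebra_simps)
  qed (simp add: esym_empty)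
qed

text \<open>Expanding the power reproduces every monomial, with only nonnegative terms added; the
  lost factor \<open>m!\<close> is harmless below.\<close>

lemma norm_esym_le:
  fixes f :: "'i \<Rightarrow> 'a::{comm_ring_1, real_normed_algebra_1}"
  assumes "finite S"
  shows "norm (esym f S m) \<le> (\<Sum>j\<in>S. norm (f j)) ^ m"
  using assms
proof (induction S arbitrary: m rule: finite_induct)
  case empty
  then show ?case by (simp add: esym_empty)
next
  case (insert x S)
  let ?s = "\<Sum>j\<in>S. norm (f j)"
  show ?case
  proof (cases m)
    case 0
    then show ?thesis by (simp add: esym_0)
  next
    case (Suc m')
    have "norm (esym f (insert x S) m) \<le> norm (esym f S (Suc m')) + norm (f x) * norm (esym f S m')"
      unfolding Suc esym_insert_Suc[OF insert.hyps]
      by (meson norm_triangle_le add_left_mono norm_mult_ineq order.trans norm_triangle_ineq)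
    also have "\<dots> \<le> ?s ^ Suc m' + norm (f x) * ?s ^ m'"
      by (intro add_mono mult_left_mono insert.IH) auto
    also have "\<dots> = (norm (f x) + ?s) * ?s ^ m'"
      by (simp add: algebra_simps)
    also have "\<dots> \<le> (norm (f x) + ?s) * (norm (f x) + ?s) ^ m'"
      by (intro mult_left_mono power_mono add_nonneg_nonneg sum_nonneg) (auto simp: sum_nonneg)
    finally show ?thesis
      using insert.hyps by (simp add: Suc)
  qed
qed

section \<open>Splitting off the exceptional entry\<close>

definition zn_weight :: "complex \<Rightarrow> nat \<Rightarrow> nat \<Rightarrow> complex" where
  "zn_weight q s k = q ^ ((s - 1) * k) / q_number q k ^ s"

lemma increasing_tuples_Suc:
  "increasing_tuples (Suc r) n =
     (\<lambda>(k, ks). ks @ [k]) ` (SIGMA k:{1..<n}. increasing_tuples r k)"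
proof (intro set_eqI iffI)
  fix xs assume xs: "xs \<in> increasing_tuples (Suc r) n"
  then have "xs \<noteq> []"
    by (auto simp: increasing_tuples_def)
  then obtain ks k where eq: "xs = ks @ [k]"
    by (metis rev_exhaust)
  have "(k, ks) \<in> (SIGMA k:{1..<n}. increasing_tuples r k)"
    using xs by (auto simp: increasing_tuples_def eq sorted_wrt_append)
  then show "xs \<in> (\<lambda>(k, ks). ks @ [k]) ` (SIGMA k:{1..<n}. increasing_tuples r k)"
    unfolding eq by force
qed (force simp: increasing_tuples_def sorted_wrt_append)

text \<open>The largest index \<open>k\<close> is summed last. The first argument of
  \<open>zn\<close> acts only as an upper bound for the indices, so on the right it is
  \<open>k\<close> and no longer the order of \<open>q\<close>.\<close>

lemma zn_snoc:
  "zn n (s @ [c]) q = (\<Sum>k\<in>{1..<n}. zn k s q * zn_weight q c k)"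
proof -
  let ?g = "\<lambda>ks. \<Prod>i<length (s @ [c]).
      q ^ (((s @ [c]) ! i - 1) * (ks ! i)) / q_number q (ks ! i) ^ ((s @ [c]) ! i)"
  have inj: "inj_on (\<lambda>(k, ks). ks @ [k]) (SIGMA k:{1..<n}. increasing_tuples (length s) k)"
    by (auto simp: inj_on_def)
  have "zn n (s @ [c]) q = (\<Sum>ks\<in>increasing_tuples (Suc (length s)) n. ?g ks)"
    by (simp add: zn_def)
  also have "\<dots> = (\<Sum>p\<in>(SIGMA k:{1..<n}. increasing_tuples (length s) k). ?g (snd p @ [fst p]))"
    unfolding increasing_tuples_Suc sum.reindex[OF inj]
    by (intro sum.cong) (auto simp: case_prod_unfold)
  also have "\<dots> = (\<Sum>k\<in>{1..<n}. \<Sum>ks\<in>increasing_tuples (length s) k. ?g (ks @ [k]))"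
    by (subst sum.Sigma) (auto simp: finite_increasing_tuples case_prod_unfold)
  also have "\<dots> = (\<Sum>k\<in>{1..<n}. zn k s q * zn_weight q c k)"
  proof (intro sum.cong refl)
    fix k
    have "?g (ks @ [k]) = (\<Prod>i<length s. q ^ ((s ! i - 1) * (ks ! i)) / q_number q (ks ! i) ^ (s ! i))
        * zn_weight q c k" if "ks \<in> increasing_tuples (length s) k" for ks
    proof -
      have "length ks = length s"
        using that by (simp add: increasing_tuples_def)
      moreover have "(\<Prod>i<length s. q ^ (((s @ [c]) ! i - 1) * ((ks @ [k]) ! i)) /
            q_number q ((ks @ [k]) ! i) ^ ((s @ [c]) ! i)) =
          (\<Prod>i<length s. q ^ ((s ! i - 1) * (ks ! i)) / q_number q (ks ! i) ^ (s ! i))"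
        using calculation by (intro prod.cong) (auto simp: nth_append)
      ultimately show ?thesis
        by (simp add: zn_weight_def nth_append)
    qed
    then show "(\<Sum>ks\<in>increasing_tuples (length s) k. ?g (ks @ [k])) = zn k s q * zn_weight q c k"
      by (simp add: zn_def sum_distrib_right)
  qed
  finally show ?thesis .
qed

lemma zn_Nil: "zn n [] q = 1"
proof -
  have "increasing_tuples 0 n = {[]}"
    by (auto simp: increasing_tuples_def)
  then show ?thesis
    by (simp add: zn_def)
qed

lemma zn_replicate: "zn n (replicate a c) q = esym (zn_weight q c) {1..<n} a"
proof (induction a arbitrary: n)
  case 0
  then show ?case by (simp add: zn_Nil esym_0)
next
  case (Suc a)
  have "zn n (replicate (Suc a) c) q = zn n (replicate a c @ [c]) q"
    by (simp add: replicate_append_same)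
  then show ?case
    by (simp only: zn_snoc Suc esym_Suc_interval)
qed

lemma zn_replicate_mid:
  "zn n (replicate a c @ [d] @ replicate b c) q =
     (\<Sum>k\<in>{1..<n}. esym (zn_weight q c) {1..<k} a * zn_weight q d k *
        esym (zn_weight q c) {Suc k..<n} b)"
proof (induction b arbitrary: n)
  case 0
  then show ?case
    by (simp add: zn_snoc zn_replicate esym_0)
next
  case (Suc b)
  let ?e = "esym (zn_weight q c)"
  have "zn n (replicate a c @ [d] @ replicate (Suc b) c) q =
      zn n ((replicate a c @ [d] @ replicate b c) @ [c]) q"
    by (simp add: replicate_append_same)
  also have "\<dots> = (\<Sum>k'\<in>{1..<n}. \<Sum>k\<in>{1..<k'}. ?e {1..<k} a * zn_weight q d k *
        ?e {Suc k..<k'} b * zn_weight q c k')"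
    by (simp only: zn_snoc Suc sum_distrib_right)
  also have "\<dots> = (\<Sum>k\<in>{1..<n}. \<Sum>k'\<in>{Suc k..<n}. ?e {1..<k} a * zn_weight q d k *
        ?e {Suc k..<k'} b * zn_weight q c k')"
    unfolding sum.Sigma[OF finite_atLeastLessThan ballI[OF finite_atLeastLessThan]]
    by (rule sum.reindex_bij_witness[of _ prod.swap prod.swap]) auto
  also have "\<dots> = (\<Sum>k\<in>{1..<n}. ?e {1..<k} a * zn_weight q d k * ?e {Suc k..<n} (Suc b))"
    by (simp add: esym_Suc_interval sum_distrib_left mult.assoc)
  finally show ?case .
qed

section \<open>Convergence\<close>

lemma convergent_esym:
  fixes \<alpha> :: "nat \<Rightarrow> 'i \<Rightarrow> 'a::{comm_ring_1, real_normed_algebra_1}"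
  assumes "finite S" "\<And>j. j \<in> S \<Longrightarrow> convergent (\<lambda>n. \<alpha> n j)"
  shows "convergent (\<lambda>n. esym (\<alpha> n) S m)"
  using assms
proof (induction S arbitrary: m rule: finite_induct)
  case empty
  then show ?case by (simp add: esym_empty convergent_const)
next
  case (insert x S)
  show ?case
  proof (cases m)
    case 0
    then show ?thesis by (simp add: esym_0 convergent_const)
  next
    case (Suc m')
    then show ?thesis
      using insert by (auto simp: esym_insert_Suc intro!: convergent_add convergent_mult)
  qed
qed

section \<open>Symmetric functions of the weights above \<open>k\<close>\<close>

lemma esym_tail_rec:
  fixes f :: "nat \<Rightarrow> 'a::comm_ring_1"
  assumes "k < n"
  shows "esym f {Suc k..<n} b = esym f {1..<n} b -
    (\<Sum>i\<in>{1..b}. esym f {1..k} i * esym f {Suc k..<n} (b - i))"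
proof -
  have "{1..<n} = {1..k} \<union> {Suc k..<n}"
    using assms by auto
  then have "esym f {1..<n} b = (\<Sum>i\<le>b. esym f {1..k} i * esym f {Suc k..<n} (b - i))"
    by (simp only:) (rule esym_union, auto)
  also have "{..b} = insert 0 {1..b}"
    by auto
  finally show ?thesis
    by (simp add: esym_0)
qed

lemma convergent_esym_tail:
  fixes \<alpha> :: "nat \<Rightarrow> nat \<Rightarrow> complex"
  assumes "\<And>j. 1 \<le> j \<Longrightarrow> convergent (\<lambda>n. \<alpha> n j)"
    and "\<And>i. i \<le> b \<Longrightarrow> convergent (\<lambda>n. esym (\<alpha> n) {1..<n} i)"
  shows "convergent (\<lambda>n. esym (\<alpha> n) {Suc k..<n} b)"
  using assms(2)
proof (induction b rule: less_induct)
  case (less b)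
  have "convergent (\<lambda>n. esym (\<alpha> n) {1..<n} b -
      (\<Sum>i\<in>{1..b}. esym (\<alpha> n) {1..k} i * esym (\<alpha> n) {Suc k..<n} (b - i)))"
    using less assms(1)
    by (intro convergent_diff convergent_sum convergent_mult convergent_esym) auto
  moreover have "\<forall>\<^sub>F n in sequentially. esym (\<alpha> n) {1..<n} b -
      (\<Sum>i\<in>{1..b}. esym (\<alpha> n) {1..k} i * esym (\<alpha> n) {Suc k..<n} (b - i)) =
      esym (\<alpha> n) {Suc k..<n} b"
    using eventually_gt_at_top[of k] by eventually_elim (rule esym_tail_rec[symmetric])
  ultimately show ?case
    by (simp add: convergent_cong)
qed

text \<open>\<open>K\<close> must be uniform in \<open>n\<close> and \<open>k\<close>, whereas the
  absolute sum of the weights above \<open>k\<close> may grow with \<open>n\<close>. In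
  \<open>esym_tail_rec\<close> the full-range term is bounded because it converges, and each other
  term pairs a bound \<open>(1 + s k)^i\<close> with the inductive bound
  \<open>(1 + s k)^(b - i)\<close>.\<close>

lemma norm_esym_tail_le:
  fixes \<alpha> :: "nat \<Rightarrow> nat \<Rightarrow> complex" and s :: "nat \<Rightarrow> real"
  assumes "\<And>n k. 2 * k \<le> n \<Longrightarrow> (\<Sum>j\<in>{1..k}. norm (\<alpha> n j)) \<le> s k"
    and "\<And>k. 0 \<le> s k"
    and "\<And>i. i \<le> b \<Longrightarrow> convergent (\<lambda>n. esym (\<alpha> n) {1..<n} i)"
  shows "\<exists>K. \<forall>n k. k < n \<longrightarrow> 2 * k \<le> n \<longrightarrow> norm (esym (\<alpha> n) {Suc k..<n} b) \<le> K * (1 + s k) ^ b"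
  using assms(3)
proof (induction b rule: less_induct)
  case (less b)
  have "\<forall>i\<in>{1..b}. \<exists>K. \<forall>n k. k < n \<longrightarrow> 2 * k \<le> n \<longrightarrow>
      norm (esym (\<alpha> n) {Suc k..<n} (b - i)) \<le> K * (1 + s k) ^ (b - i)"
    using less by auto
  then obtain K where K: "\<And>i n k. i \<in> {1..b} \<Longrightarrow> k < n \<Longrightarrow> 2 * k \<le> n \<Longrightarrow>
      norm (esym (\<alpha> n) {Suc k..<n} (b - i)) \<le> K i * (1 + s k) ^ (b - i)"
    by metis
  obtain E where E: "E > 0" "\<And>n. norm (esym (\<alpha> n) {1..<n} b) \<le> E"
    using convergent_imp_Bseq[OF less.prems[OF order_refl]] by (auto elim: BseqE)
  have "norm (esym (\<alpha> n) {Suc k..<n} b) \<le> (E + (\<Sum>i\<in>{1..b}. K i)) * (1 + s k) ^ b"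
    if kn: "k < n" "2 * k \<le> n" for n k
  proof -
    have "norm (esym (\<alpha> n) {1..k} i * esym (\<alpha> n) {Suc k..<n} (b - i)) \<le> K i * (1 + s k) ^ b"
      if i: "i \<in> {1..b}" for i
    proof -
      have "norm (esym (\<alpha> n) {1..k} i) \<le> (\<Sum>j\<in>{1..k}. norm (\<alpha> n j)) ^ i"
        by (intro norm_esym_le) simp
      also have "\<dots> \<le> (1 + s k) ^ i"
        using assms(1)[OF kn(2)] by (intro power_mono sum_nonneg) auto
      finally have "norm (esym (\<alpha> n) {1..k} i * esym (\<alpha> n) {Suc k..<n} (b - i)) \<le>
          (1 + s k) ^ i * (K i * (1 + s k) ^ (b - i))"
        unfolding norm_mult using K[OF i kn] assms(2)[of k] by (intro mult_mono) auto
      also have "\<dots> = K i * (1 + s k) ^ (i + (b - i))"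
        unfolding power_add by (simp only: mult_ac)
      finally show ?thesis
        using i by simp
    qed
    then have "norm (\<Sum>i\<in>{1..b}. esym (\<alpha> n) {1..k} i * esym (\<alpha> n) {Suc k..<n} (b - i)) \<le>
        (\<Sum>i\<in>{1..b}. K i * (1 + s k) ^ b)"
      by (rule sum_norm_le)
    moreover have "norm (esym (\<alpha> n) {1..<n} b) \<le> E * (1 + s k) ^ b"
      using E(2)[of n] one_le_power[of "1 + s k" b] assms(2)[of k] E(1)
      by (smt (verit) mult_left_le_imp_le mult_le_cancel_left1)
    ultimately show ?thesis
      unfolding distrib_right sum_distrib_right
      by (subst esym_tail_rec[OF kn(1)])
         (meson add_mono norm_triangle_ineq4 order.trans)
  qed
  then show ?case
    by blast
qed

section \<open>Domination and Tannery's theorem\<close>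

lemma log_power_over_square_bigo:
  fixes C :: real
  shows "(\<lambda>k. (1 + C * (1 + ln (real k))) ^ m / real k ^ 2) \<in> O(\<lambda>k. real k powr (-3/2))"
proof -
  \<comment> \<open>Chosen so that the \<open>m\<close>-th power of \<open>k powr e\<close> costs at
    most \<open>k powr (1/2)\<close>, which leaves the exponent -3/2.\<close>
  define e :: real where "e = 1 / (2 * (real m + 1))"
  have e: "e > 0" "e * real m \<le> 1 / 2"
    by (auto simp: e_def field_simps)
  have "(\<lambda>k. 1 + C * (1 + ln (real k))) \<in> O(\<lambda>k. real k powr e)"
    using e(1) by real_asymp
  then have "(\<lambda>k. (1 + C * (1 + ln (real k))) ^ m / real k ^ 2) \<in> O(\<lambda>k. (real k powr e) ^ m / real k ^ 2)"
    by (intro landau_o.big.divide_right landau_o.big_power) (auto intro: eventually_mono[OF eventually_gt_at_top[of 0]])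
  also have "(\<lambda>k. (real k powr e) ^ m / real k ^ 2) \<in> O(\<lambda>k. real k powr (-3/2))"
  proof (rule bigoI[of _ 1], use eventually_gt_at_top[of 0] in eventually_elim)
    fix k :: nat assume "k > 0"
    then have "(real k powr e) ^ m / real k ^ 2 = real k powr (e * real m - 2)"
      using powr_realpow[of "real k powr e" m] by (simp add: powr_powr powr_diff powr_numeral)
    also have "\<dots> \<le> real k powr (-3/2)"
      using e(2) \<open>k > 0\<close> by (intro powr_mono) auto
    finally show "norm ((real k powr e) ^ m / real k ^ 2) \<le> 1 * norm (real k powr (-3/2))"
      by simp
  qed
  finally show ?thesis .
qed

lemma summable_log_power_over_square:
  fixes C :: real
  assumes "C \<ge> 0"
  shows "summable (\<lambda>k. (1 + (\<Sum>j\<in>{1..k}. C / real j)) ^ m / real k ^ 2)"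
proof (rule summable_comparison_test_ev)
  have "summable (\<lambda>k. real k powr (-3/2))"
    by (simp add: summable_real_powr_iff)
  then have "summable (\<lambda>k. (1 + C * (1 + ln (real k))) ^ m / real k ^ 2)"
    by (intro summable_comparison_test_bigo[OF _ log_power_over_square_bigo]) simp
  then show "summable (\<lambda>k. (1 + C * (1 + ln (real k))) ^ m / real k ^ 2)" .
  have "norm ((1 + (\<Sum>j\<in>{1..k}. C / real j)) ^ m / real k ^ 2) \<le>
      (1 + C * (1 + ln (real k))) ^ m / real k ^ 2" if "k > 0" for k
  proof -
    have "(\<Sum>j\<in>{1..k}. C / real j) = C * harm k"
      by (simp add: harm_def sum_distrib_left divide_inverse)
    \<comment> \<open>\<open>harm k - ln k\<close> is decreasing and equals 1 at
      \<open>k = 1\<close>.\<close>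
    also have "\<dots> \<le> C * (1 + ln (real k))"
      using decseqD[OF decseq_harm_diff_ln, of 0 "k - 1"] that assms
      by (intro mult_left_mono) (auto simp: harm_expand)
    finally have le: "(\<Sum>j\<in>{1..k}. C / real j) \<le> C * (1 + ln (real k))" .
    have nonneg: "0 \<le> (\<Sum>j\<in>{1..k}. C / real j)"
      using assms by (intro sum_nonneg) auto
    then have "norm ((1 + (\<Sum>j\<in>{1..k}. C / real j)) ^ m / real k ^ 2) =
        (1 + (\<Sum>j\<in>{1..k}. C / real j)) ^ m / real k ^ 2"
      by simp
    also have "\<dots> \<le> (1 + C * (1 + ln (real k))) ^ m / real k ^ 2"
      using le nonneg by (intro divide_right_mono power_mono) auto
    finally show ?thesis .
  qed
  then show "\<forall>\<^sub>F k in sequentially. norm ((1 + (\<Sum>j\<in>{1..k}. C / real j)) ^ m / real k ^ 2) \<le>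
      (1 + C * (1 + ln (real k))) ^ m / real k ^ 2"
    using eventually_gt_at_top[of 0] by (rule eventually_mono[rotated])
qed

text \<open>By Tannery's theorem with majorant a multiple of \<open>(1 + s k)^(a + b) / k^2\<close>.
  The cutoff \<open>c\<close> is left abstract because the two halves of the full sum treat a middle
  index \<open>n/2\<close> differently.\<close>

lemma convergent_half_sum:
  fixes \<alpha> \<mu> :: "nat \<Rightarrow> nat \<Rightarrow> complex" and C :: real
  assumes cutoff: "filterlim c at_top sequentially" "\<And>n k. k < c n \<Longrightarrow> 2 * k \<le> n"
    and C: "C \<ge> 0"
    and \<alpha>: "\<And>j. 1 \<le> j \<Longrightarrow> convergent (\<lambda>n. \<alpha> n j)"
      "\<And>n j. 1 \<le> j \<Longrightarrow> 2 * j \<le> n \<Longrightarrow> norm (\<alpha> n j) \<le> C / real j"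
    and \<mu>: "\<And>j. 1 \<le> j \<Longrightarrow> convergent (\<lambda>n. \<mu> n j)"
      "\<And>n j. 1 \<le> j \<Longrightarrow> 2 * j \<le> n \<Longrightarrow> norm (\<mu> n j) \<le> C / real j ^ 2"
    and e: "\<And>i. i \<le> b \<Longrightarrow> convergent (\<lambda>n. esym (\<alpha> n) {1..<n} i)"
  shows "convergent (\<lambda>n. \<Sum>k\<in>{1..<c n}. esym (\<alpha> n) {1..<k} a * \<mu> n k * esym (\<alpha> n) {Suc k..<n} b)"
proof -
  define s where "s = (\<lambda>k. \<Sum>j\<in>{1..k}. C / real j)"
  have s0: "0 \<le> s k" for k
    using C by (auto simp: s_def intro!: sum_nonneg)
  have s: "(\<Sum>j\<in>{1..k}. norm (\<alpha> n j)) \<le> s k" if "2 * k \<le> n" for n k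
    unfolding s_def using that by (intro sum_mono \<alpha>(2)) auto
  obtain K where K: "\<And>n k. k < n \<Longrightarrow> 2 * k \<le> n \<Longrightarrow>
      norm (esym (\<alpha> n) {Suc k..<n} b) \<le> K * (1 + s k) ^ b"
    using norm_esym_tail_le[of \<alpha> s b] s s0 e by blast
  define T where "T = (\<lambda>n k. esym (\<alpha> n) {1..<k} a * \<mu> n k * esym (\<alpha> n) {Suc k..<n} b)"
  \<comment> \<open>Extension by 0 beyond the cutoff turns the finite sums into series over all
    \<open>k\<close>.\<close>
  define A where "A = (\<lambda>k n. if k \<in> {1..<c n} then T n k else 0)"
  have conv: "convergent (A k)" for k
  proof (cases "k = 0")
    case True
    then show ?thesis by (simp add: A_def convergent_const)
  next
    case False
    have "\<forall>\<^sub>F n in sequentially. Suc k \<le> c n"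
      using cutoff(1) by (simp add: filterlim_at_top del: Suc_le_eq)
    then have "\<forall>\<^sub>F n in sequentially. A k n = T n k"
      by eventually_elim (use False in \<open>simp add: A_def\<close>)
    moreover have "convergent (\<lambda>n. T n k)"
      unfolding T_def using \<alpha>(1) \<mu>(1) e False
      by (intro convergent_mult convergent_esym convergent_esym_tail) auto
    ultimately show ?thesis
      by (simp add: convergent_cong)
  qed
  have bound: "norm (A k n) \<le> C * K * ((1 + s k) ^ (a + b) / real k ^ 2)" for k n
  proof (cases "k \<in> {1..<c n}")
    case True
    then have kn: "2 * k \<le> n" "1 \<le> k" "k < n"
      using cutoff(2)[of k n] by auto
    have "(\<Sum>j\<in>{1..<k}. norm (\<alpha> n j)) \<le> (\<Sum>j\<in>{1..k}. norm (\<alpha> n j))"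
      by (intro sum_mono2) auto
    also have "\<dots> \<le> 1 + s k"
      using s[OF kn(1)] by simp
    finally have "(\<Sum>j\<in>{1..<k}. norm (\<alpha> n j)) ^ a \<le> (1 + s k) ^ a"
      by (intro power_mono sum_nonneg) auto
    then have e_le: "norm (esym (\<alpha> n) {1..<k} a) \<le> (1 + s k) ^ a"
      using norm_esym_le[of "{1..<k}" "\<alpha> n" a] by auto
    have "norm (T n k) \<le> (1 + s k) ^ a * (C / real k ^ 2) * (K * (1 + s k) ^ b)"
      unfolding T_def norm_mult using e_le K[OF kn(3,1)] \<mu>(2)[OF kn(2,1)] s0[of k] C
      by (intro mult_mono mult_nonneg_nonneg) auto
    also have "(1 + s k) ^ a * (C / real k ^ 2) * (K * (1 + s k) ^ b) =
        C * K * ((1 + s k) ^ (a + b) / real k ^ 2)"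
      by (simp add: power_add)
    finally show ?thesis
      using True by (simp add: A_def)
  next
    case False
    \<comment> \<open>The instance \<open>k = 0\<close>, \<open>n = 1\<close> of the bound forces
      \<open>K\<close> to be nonnegative, since \<open>s 0 = 0\<close>.\<close>
    have "0 \<le> K * (1 + s 0) ^ b"
      by (rule order.trans[OF norm_ge_zero K[of 0 1]]) auto
    then have "0 \<le> K"
      by (simp add: s_def)
    then show ?thesis
      unfolding A_def using False C s0[of k] by auto
  qed
  have "summable (\<lambda>k. C * K * ((1 + s k) ^ (a + b) / real k ^ 2))"
    unfolding s_def by (intro summable_mult summable_log_power_over_square C)
  then have "(\<lambda>n. suminf (\<lambda>k. A k n)) \<longlonglongrightarrow> suminf (\<lambda>k. lim (A k))"
    using tannerys_theorem[of A "\<lambda>k. lim (A k)" sequentially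
        "\<lambda>k. C * K * ((1 + s k) ^ (a + b) / real k ^ 2)"] conv bound
    by (simp add: convergent_LIMSEQ_iff case_prod_unfold)
  moreover have "suminf (\<lambda>k. A k n) = (\<Sum>k\<in>{1..<c n}. T n k)" for n
    by (subst suminf_finite[of "{1..<c n}"]) (auto simp: A_def intro!: sum.cong)
  ultimately show ?thesis
    by (auto simp: convergent_def T_def)
qed

lemma esym_reflect:
  fixes f :: "nat \<Rightarrow> 'a::comm_ring_1"
  assumes "h \<le> Suc n"
  shows "esym (\<lambda>j. f (n - j)) {l..<h} m = esym f {Suc n - h..<Suc n - l} m"
proof -
  have "(\<lambda>j. n - j) ` {l..<h} = {Suc n - h..<Suc n - l}"
  proof (intro set_eqI iffI)
    fix x assume "x \<in> {Suc n - h..<Suc n - l}"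
    then have "x = n - (n - x)" "n - x \<in> {l..<h}"
      using assms by auto
    then show "x \<in> (\<lambda>j. n - j) ` {l..<h}"
      by blast
  qed (use assms in auto)
  moreover have "inj_on (\<lambda>j. n - j) {l..<h}"
    using assms by (auto simp: inj_on_def)
  ultimately show ?thesis
    using esym_reindex[of "\<lambda>j. n - j" "{l..<h}" f m] by (simp add: comp_def)
qed

lemma sum_reflect:
  fixes g :: "nat \<Rightarrow> 'a::comm_monoid_add"
  shows "(\<Sum>k\<in>{1..<n}. g (n - k)) = sum g {1..<n}"
  by (rule sum.reindex_bij_witness[of _ "\<lambda>k. n - k" "\<lambda>k. n - k"]) auto

text \<open>The indices below \<open>n/2\<close> are covered by \<open>convergent_half_sum\<close>;
  the others are reflected by \<open>k\<close> to \<open>n - k\<close>, which interchanges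
  \<open>a\<close> and \<open>b\<close>.\<close>

lemma convergent_mid_sum:
  fixes \<alpha> \<mu> :: "nat \<Rightarrow> nat \<Rightarrow> complex" and C :: real
  assumes C: "C \<ge> 0"
    and \<alpha>: "\<And>j. 1 \<le> j \<Longrightarrow> convergent (\<lambda>n. \<alpha> n j)"
      "\<And>j. 1 \<le> j \<Longrightarrow> convergent (\<lambda>n. \<alpha> n (n - j))"
      "\<And>n j. 1 \<le> j \<Longrightarrow> 2 * j \<le> n \<Longrightarrow> norm (\<alpha> n j) \<le> C / real j"
      "\<And>n j. 1 \<le> j \<Longrightarrow> 2 * j \<le> n \<Longrightarrow> norm (\<alpha> n (n - j)) \<le> C / real j"
    and \<mu>: "\<And>j. 1 \<le> j \<Longrightarrow> convergent (\<lambda>n. \<mu> n j)"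
      "\<And>j. 1 \<le> j \<Longrightarrow> convergent (\<lambda>n. \<mu> n (n - j))"
      "\<And>n j. 1 \<le> j \<Longrightarrow> 2 * j \<le> n \<Longrightarrow> norm (\<mu> n j) \<le> C / real j ^ 2"
      "\<And>n j. 1 \<le> j \<Longrightarrow> 2 * j \<le> n \<Longrightarrow> norm (\<mu> n (n - j)) \<le> C / real j ^ 2"
    and e: "\<And>i. i \<le> max a b \<Longrightarrow> convergent (\<lambda>n. esym (\<alpha> n) {1..<n} i)"
  shows "convergent (\<lambda>n. \<Sum>k\<in>{1..<n}. esym (\<alpha> n) {1..<k} a * \<mu> n k * esym (\<alpha> n) {Suc k..<n} b)"
proof -
  define T where "T = (\<lambda>n k. esym (\<alpha> n) {1..<k} a * \<mu> n k * esym (\<alpha> n) {Suc k..<n} b)"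
  \<comment> \<open>For even \<open>n\<close> the middle index \<open>n/2\<close> is left out of the
    direct half and included in the reflected one.\<close>
  have half: "filterlim (\<lambda>n. (n + 1) div 2) at_top sequentially"
    "filterlim (\<lambda>n. n div 2 + 1) at_top sequentially"
  proof -
    have "Z \<le> (n + 1) div 2 \<and> Z \<le> n div 2 + 1" if "2 * Z \<le> n" for Z n :: nat
      using that by auto
    then show "filterlim (\<lambda>n. (n + 1) div 2) at_top sequentially"
      "filterlim (\<lambda>n. n div 2 + 1) at_top sequentially"
      unfolding filterlim_at_top eventually_sequentially by blast+
  qed
  have "convergent (\<lambda>n. \<Sum>k\<in>{1..<(n + 1) div 2}. T n k)"
    unfolding T_def by (rule convergent_half_sum[OF half(1) _ C]) (use \<alpha> \<mu> e in auto)
  moreover have "convergent (\<lambda>n. \<Sum>k\<in>{1..<n div 2 + 1}. esym (\<lambda>j. \<alpha> n (n - j)) {1..<k} b *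
      \<mu> n (n - k) * esym (\<lambda>j. \<alpha> n (n - j)) {Suc k..<n} a)"
    by (rule convergent_half_sum[OF half(2) _ C]) (use \<alpha> \<mu> e in \<open>auto simp: esym_reflect\<close>)
  moreover have "(\<Sum>k\<in>{1..<n div 2 + 1}. esym (\<lambda>j. \<alpha> n (n - j)) {1..<k} b *
      \<mu> n (n - k) * esym (\<lambda>j. \<alpha> n (n - j)) {Suc k..<n} a) = (\<Sum>k\<in>{(n + 1) div 2..<n}. T n k)" for n
    by (rule sum.reindex_bij_witness[of _ "\<lambda>k. n - k" "\<lambda>k. n - k"])
       (auto simp: T_def esym_reflect Suc_diff_le mult_ac)
  ultimately have "convergent (\<lambda>n. (\<Sum>k\<in>{1..<(n + 1) div 2}. T n k) + (\<Sum>k\<in>{(n + 1) div 2..<n}. T n k))"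
    by (simp add: convergent_add)
  moreover have "(\<Sum>k\<in>{1..<(n + 1) div 2}. T n k) + (\<Sum>k\<in>{(n + 1) div 2..<n}. T n k) =
      (\<Sum>k\<in>{1..<n}. T n k)" for n
    by (cases "n = 0") (auto intro!: sum.atLeastLessThan_concat)
  ultimately show ?thesis
    by (simp add: T_def)
qed

section \<open>The symmetrized generating function at a root of unity\<close>

lemma coeff_one_plus_power: "coeff ([:1, c:] ^ n) i = of_nat (n choose i) * (c::complex) ^ i"
proof (cases "i \<le> n")
  case False
  have "degree ([:1, c:] ^ n) \<le> n"
    using degree_power_le[of "[:1, c:]" n] by (simp split: if_splits)
  with False show ?thesis
    by (simp add: coeff_eq_0)
qed (simp add: coeff_linear_poly_power)

lemma poly_eq_sum_coeff:
  fixes p :: "'a::comm_semiring_1 poly"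
  assumes "degree p < N"
  shows "poly p x = (\<Sum>i<N. coeff p i * x ^ i)"
proof -
  have "(\<Sum>i<N. coeff p i * x ^ i) = (\<Sum>i\<le>degree p. coeff p i * x ^ i)"
    using assms by (intro sum.mono_neutral_right) (auto simp: coeff_eq_0)
  then show ?thesis
    unfolding poly_altdef by (rule sym)
qed

lemma sum_powers_eq_0_imp_coeff_eq_0:
  fixes c :: "nat \<Rightarrow> 'a::idom"
  assumes "N \<le> card S" "\<And>x. x \<in> S \<Longrightarrow> (\<Sum>i<N. c i * x ^ i) = 0" "i < N"
  shows "c i = 0"
proof -
  define p where "p = (\<Sum>i<N. monom (c i) i)"
  have coeff: "coeff p j = (if j < N then c j else 0)" for j
    by (simp add: p_def coeff_sum)
  have "p = 0"
  proof (rule poly_eqI_degree[of S])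
    have "degree p < N"
      using assms(3) coeff by (intro degree_lessI) auto
    then show "degree p < card S" "degree (0 :: 'a poly) < card S"
      using assms(1) by auto
  qed (use assms(2) in \<open>simp add: p_def poly_sum poly_monom\<close>)
  then show ?thesis
    using coeff[of i] assms(3) by simp
qed

text \<open>One variable at a time: for fixed \<open>y\<close> the coefficients in \<open>x\<close>
  vanish, and each of them is a polynomial in \<open>y\<close> vanishing on
  \<open>S\<close>.\<close>

lemma double_sum_powers_eq_0_imp_coeff_eq_0:
  fixes c :: "nat \<Rightarrow> nat \<Rightarrow> 'a::idom"
  assumes "N \<le> card S"
    and "\<And>x y. x \<in> S \<Longrightarrow> y \<in> S \<Longrightarrow> (\<Sum>i<N. \<Sum>j<N. c i j * x ^ i * y ^ j) = 0"
    and "i < N" "j < N"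
  shows "c i j = 0"
proof -
  have "(\<Sum>j<N. c i j * y ^ j) = 0" if "y \<in> S" for y
    using assms(2)[OF _ that] assms(1,3)
    by (intro sum_powers_eq_0_imp_coeff_eq_0[where c = "\<lambda>i. \<Sum>j<N. c i j * y ^ j"])
       (auto simp: sum_distrib_right sum_distrib_left mult_ac)
  then show ?thesis
    by (rule sum_powers_eq_0_imp_coeff_eq_0[OF assms(1) _ assms(4)])
qed

section \<open>Products over the powers of a primitive root of unity\<close>

locale primitive_root =
  fixes n :: nat and q :: complex
  assumes n2: "n \<ge> 2" and qn: "q ^ n = 1" and q_neq: "\<And>j. 1 \<le> j \<Longrightarrow> j < n \<Longrightarrow> q ^ j \<noteq> 1"
begin

definition t where "t = 1 - q"
definition u where "u j = t / (1 - q ^ j)"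
definition v where "v j = q ^ j * u j ^ 2"
text \<open>The zeros of \<open>\<Prod>(1 + x u j)\<close>, where the two-variable generating function of the sums
  \<open>z\<^sub>n({1}\<^sup>a, 2, {1}\<^sup>b)\<close> can be evaluated in closed form.\<close>

definition node where "node m = (q ^ m - 1) / t"

lemma q_nz: "q \<noteq> 0"
  using qn n2 by (auto simp: power_0_left)

lemma t_nz: "t \<noteq> 0"
  using q_neq[of 1] n2 by (auto simp: t_def)

lemma q_power_inj: "i < n \<Longrightarrow> j < n \<Longrightarrow> q ^ i = q ^ j \<Longrightarrow> i = j"
proof (induction i j rule: linorder_wlog)
  case (le i j)
  have "q ^ i * q ^ (j - i) = q ^ i * 1"
    using le power_add[of q i "j - i"] by simp
  then show ?case
    using q_nz q_neq[of "j - i"] le by (cases "i = j") auto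
qed simp

lemma u_eq: "u j = 1 / q_number q j"
proof -
  have "1 - q ^ j = t * q_number q j"
    by (simp add: t_def q_number_def one_diff_power_eq)
  then show ?thesis
    using t_nz by (simp add: u_def)
qed

lemma zn_weight_1: "zn_weight q 1 j = u j"
  by (simp add: zn_weight_def u_eq)

lemma zn_weight_2: "zn_weight q 2 j = v j"
  by (simp add: zn_weight_def v_def u_eq power_one_over)

lemma one_plus_u: "1 \<le> j \<Longrightarrow> j < n \<Longrightarrow> 1 + x * u j = ((1 + x * t) - q ^ j) / (1 - q ^ j)"
  using q_neq[of j] by (simp add: u_def field_simps)

text \<open>Both sides are monic of degree \<open>n - 1\<close> in \<open>z\<close> and vanish at
  the \<open>n - 1\<close> distinct powers \<open>q^j\<close>.\<close>

lemma prod_diff_powers: "(\<Prod>j\<in>{1..<n}. z - q ^ j) = (\<Sum>i<n. z ^ i)"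
proof -
  define P where "P = (\<Prod>j\<in>{1..<n}. [:- (q ^ j), 1:])"
  define R :: "complex poly" where "R = (\<Sum>i<n. monom 1 i)"
  have dP: "degree P = n - 1"
    unfolding P_def by (subst degree_prod_sum_eq) auto
  have "P = R"
  proof (rule poly_eqI_degree_lead_coeff[of _ "n - 1" _ "(\<lambda>j. q ^ j) ` {1..<n}"])
    have "lead_coeff P = 1"
      unfolding P_def by (simp add: lead_coeff_prod)
    moreover have "coeff R (n - 1) = 1"
      using n2 by (simp add: R_def coeff_sum)
    ultimately show "coeff P (n - 1) = coeff R (n - 1)"
      by (simp add: dP)
    show "n - 1 \<le> card ((\<lambda>j. q ^ j) ` {1..<n})"
      by (subst card_image) (auto intro!: inj_onI q_power_inj)
    show "degree R \<le> n - 1"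
      unfolding R_def by (rule degree_sum_le) (auto intro: order.trans[OF degree_monom_le])
    fix z assume "z \<in> (\<lambda>j. q ^ j) ` {1..<n}"
    then obtain j where j: "z = q ^ j" "1 \<le> j" "j < n"
      by auto
    have "z ^ n = 1"
      by (simp add: j(1) power_mult[symmetric] mult.commute[of j n]) (simp add: power_mult qn)
    then have "(\<Sum>i<n. z ^ i) = 0"
      using q_neq[OF j(2,3)] by (simp add: j(1) geometric_sum)
    then show "poly P z = poly R z"
      using j by (auto simp: P_def R_def poly_prod poly_sum poly_monom)
  qed (simp add: dP)
  then have "poly P z = poly R z"
    by simp
  then show ?thesis
    by (simp add: P_def R_def poly_prod poly_sum poly_monom)
qed

lemma prod_one_minus_powers: "(\<Prod>j\<in>{1..<n}. 1 - q ^ j) = of_nat n"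
  by (simp only: prod_diff_powers) simp

text \<open>With \<open>X = 1 + x t\<close> the product is
  \<open>(1 + X + ... + X^(n-1)) / n\<close>, and \<open>X - 1 = x t\<close>. Multiplying out keeps
  \<open>x = 0\<close> unexceptional.\<close>

lemma prod_one_plus_u: "of_nat n * t * x * (\<Prod>j\<in>{1..<n}. 1 + x * u j) = (1 + x * t) ^ n - 1"
proof -
  have "(\<Prod>j\<in>{1..<n}. 1 + x * u j) = (\<Prod>j\<in>{1..<n}. ((1 + x * t) - q ^ j) / (1 - q ^ j))"
    by (intro prod.cong one_plus_u) auto
  also have "\<dots> = (\<Sum>i<n. (1 + x * t) ^ i) / of_nat n"
    by (simp only: prod_dividef prod_one_minus_powers) (simp only: prod_diff_powers)
  finally show ?thesis
    using n2 power_diff_1_eq[of "1 + x * t" n] by simp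
qed

lemma prod_u_poly: "[:0, of_nat n * t:] * (\<Prod>j\<in>{1..<n}. [:1, u j:]) = [:1, t:] ^ n - 1"
proof (rule poly_ext)
  fix x
  show "poly ([:0, of_nat n * t:] * (\<Prod>j\<in>{1..<n}. [:1, u j:])) x = poly ([:1, t:] ^ n - 1) x"
    using prod_one_plus_u[of x] by (simp add: poly_prod mult_ac)
qed

lemma esym_u_all: "esym u {1..<n} m = of_nat (n choose Suc m) * t ^ m / of_nat n"
proof -
  have "coeff ([:0, of_nat n * t:] * (\<Prod>j\<in>{1..<n}. [:1, u j:])) (Suc m) =
      coeff ([:1, t:] ^ n - 1) (Suc m)"
    by (simp only: prod_u_poly)
  then have "of_nat n * t * esym u {1..<n} m = of_nat (n choose Suc m) * t ^ Suc m"
    by (simp add: esym_def coeff_one_plus_power coeff_pCons)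
  then show ?thesis
    using n2 t_nz by (simp add: field_simps)
qed

section \<open>The generating function and its \<open>q\<close>-shift\<close>

definition F where
  "F x y = (\<Sum>k\<in>{1..<n}. (\<Prod>j\<in>{1..<k}. 1 + x * u j) * v k * (\<Prod>j\<in>{Suc k..<n}. 1 + y * u j))"

text \<open>The generating function in the coordinates \<open>X = 1 + x t\<close>, \<open>Y = 1 + y t\<close>, which turn the nodes
  into the powers of \<open>q\<close>.\<close>

definition G where
  "G X Y = (\<Sum>k\<in>{1..<n}. (\<Prod>j\<in>{1..<k}. (X - q ^ j) / (1 - q ^ j)) * v k *
     (\<Prod>j\<in>{Suc k..<n}. (Y - q ^ j) / (1 - q ^ j)))"

lemma F_eq_G: "F x y = G (1 + x * t) (1 + y * t)"
  unfolding F_def G_def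
  by (intro sum.cong arg_cong2[of _ _ _ _ "(*)"] prod.cong one_plus_u refl) auto

text \<open>The defect in the \<open>q\<close>-shift of \<open>G\<close>, see
  \<open>G_shift\<close>. Unlike in \<open>G\<close>, the first product starts at
  \<open>j = 0\<close>.\<close>

definition W where
  "W X Y = (\<Sum>k\<in>{1..<n}. q ^ k * (\<Prod>j<k - 1. X - q ^ j) * (\<Prod>j\<in>{Suc k..<n}. Y - q ^ j))"

lemma W_telescope:
  "W X Y * (q * X - Y) = q ^ n * (\<Prod>j<n - 1. X - q ^ j) - q * (\<Prod>j\<in>{1..<n}. Y - q ^ j)"
proof -
  \<comment> \<open>Writing \<open>q X - Y = q (X - q^(k-1)) - (Y - q^k)\<close>, each of the two
    parts extends one of the products in \<open>W\<close> by a factor, so the summands become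
    differences of \<open>Z\<close>.\<close>
  define Z where "Z = (\<lambda>k. q * q ^ k * (\<Prod>j<k. X - q ^ j) * (\<Prod>j\<in>{Suc k..<n}. Y - q ^ j))"
  have "q ^ k * (\<Prod>j<k - 1. X - q ^ j) * (\<Prod>j\<in>{Suc k..<n}. Y - q ^ j) * (q * X - Y) = Z k - Z (k - 1)"
    if k: "k \<in> {1..<n}" for k
  proof -
    obtain k' where k': "k = Suc k'"
      using k by (cases k) auto
    have "{k..<n} = insert k {Suc k..<n}"
      using k by auto
    then have "(\<Prod>j\<in>{Suc k'..<n}. Y - q ^ j) = (Y - q ^ k) * (\<Prod>j\<in>{Suc k..<n}. Y - q ^ j)"
      by (simp add: k')
    then have "Z k' = q * q ^ k' * (\<Prod>j<k'. X - q ^ j) * ((Y - q ^ k) * (\<Prod>j\<in>{Suc k..<n}. Y - q ^ j))"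
      by (simp only: Z_def)
    then show ?thesis
      unfolding k' diff_Suc_1 by (simp add: Z_def algebra_simps)
  qed
  then have "W X Y * (q * X - Y) = (\<Sum>k\<in>{1..<n}. Z k - Z (k - 1))"
    unfolding W_def sum_distrib_right by (intro sum.cong) auto
  also have "{1..<n} = {Suc 0..n - 1}"
    using n2 by auto
  also have "(\<Sum>k\<in>\<dots>. Z k - Z (k - 1)) = Z (n - 1) - Z 0"
    by (rule sum_telescope'') simp
  finally show ?thesis
    using n2 by (simp add: Z_def flip: power_Suc)
qed

text \<open>Holds summand by summand. As \<open>q X - q^j = q (X - q^(j-1))\<close>, the first
  products at \<open>q X\<close> and at \<open>X\<close>, with their prefactors, share the factor
  \<open>M\<close>; the cofactors differ by \<open>X (1 - q^k)\<close>, which together with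
  \<open>v k\<close> gives the summand of \<open>W\<close>.\<close>

lemma G_shift:
  "(1 - q * X) * G (q * X) Y = (1 - X) * G X Y + t ^ 2 * X / of_nat n * W X Y"
proof -
  have step: "(1 - q * X) * ((\<Prod>j\<in>{1..<k}. (q * X - q ^ j) / (1 - q ^ j)) * v k *
      (\<Prod>j\<in>{Suc k..<n}. (Y - q ^ j) / (1 - q ^ j))) =
    (1 - X) * ((\<Prod>j\<in>{1..<k}. (X - q ^ j) / (1 - q ^ j)) * v k *
      (\<Prod>j\<in>{Suc k..<n}. (Y - q ^ j) / (1 - q ^ j))) +
    t ^ 2 * X / of_nat n * (q ^ k * (\<Prod>j<k - 1. X - q ^ j) * (\<Prod>j\<in>{Suc k..<n}. Y - q ^ j))"
    (is "?l = ?r")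
    if k: "k \<in> {1..<n}" for k
  proof -
    obtain k' where k': "k = Suc k'"
      using k by (cases k) auto
    define D1 D2 M N where "D1 = (\<Prod>j\<in>{1..<k}. 1 - q ^ j)" and "D2 = (\<Prod>j\<in>{Suc k..<n}. 1 - q ^ j)"
      and "M = (\<Prod>j<k'. X - q ^ j)" and "N = (\<Prod>j\<in>{Suc k..<n}. Y - q ^ j)"
    have "{1..<n} = insert k ({1..<k} \<union> {Suc k..<n})"
      using k by auto
    then have "(\<Prod>j\<in>{1..<n}. 1 - q ^ j) = (1 - q ^ k) * (D1 * D2)"
      unfolding D1_def D2_def by (subst prod.union_disjoint[symmetric]) auto
    then have n_eq: "of_nat n = (1 - q ^ k) * (D1 * D2)"
      by (simp only: prod_one_minus_powers)
    then have nz: "1 - q ^ k \<noteq> 0" "D1 \<noteq> 0" "D2 \<noteq> 0"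
      using n2 by auto
    have shift: "(\<Prod>j\<in>{1..<k}. f j) = (\<Prod>j<k'. f (Suc j))" for f :: "nat \<Rightarrow> complex"
      unfolding k' One_nat_def prod.atLeast_Suc_lessThan_Suc_shift by (simp add: atLeast0LessThan)
    have "(\<Prod>j\<in>{1..<k}. q * X - q ^ j) = (\<Prod>j<k'. q * (X - q ^ j))"
      unfolding shift by (simp add: algebra_simps)
    then have A1: "(\<Prod>j\<in>{1..<k}. q * X - q ^ j) = q ^ k' * M"
      by (simp add: M_def prod.distrib)
    have "(\<Prod>j<k. X - q ^ j) = (X - 1) * (\<Prod>j\<in>{1..<k}. X - q ^ j)"
      unfolding shift by (simp only: k' prod.lessThan_Suc_shift comp_def power_0)
    then have A2: "(1 - X) * (\<Prod>j\<in>{1..<k}. X - q ^ j) = - (M * (X - q ^ k'))"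
      by (simp add: M_def k' algebra_simps)
    have "?l = (1 - q * X) * (q ^ k' * M) * (v k * N / (D1 * D2))"
      unfolding prod_dividef A1 by (simp add: D1_def D2_def N_def)
    also have "(1 - q * X) * (q ^ k' * M) = - (M * (X - q ^ k')) + M * X * (1 - q ^ k)"
      by (simp add: k' algebra_simps)
    also have "\<dots> * (v k * N / (D1 * D2)) =
        (1 - X) * ((\<Prod>j\<in>{1..<k}. X - q ^ j) / D1 * v k * (N / D2)) +
        M * X * (1 - q ^ k) * (v k * N / (D1 * D2))"
      unfolding A2[symmetric] by (simp add: algebra_simps add_divide_distrib diff_divide_distrib)
    also have "M * X * (1 - q ^ k) * (v k * N / (D1 * D2)) = t ^ 2 * X / of_nat n * (q ^ k * M * N)"
    proof -
      define z where "z = 1 - q ^ k"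
      have "v k = t ^ 2 * q ^ k / z ^ 2"
        by (simp add: v_def u_def z_def power_divide)
      then show ?thesis
        using nz unfolding n_eq z_def[symmetric] by (simp add: field_simps power2_eq_square)
    qed
    finally show ?thesis
      unfolding prod_dividef by (simp add: D1_def D2_def N_def M_def k')
  qed
  show ?thesis
    unfolding G_def W_def sum_distrib_left sum.distrib[symmetric]
    by (intro sum.cong refl step)
qed

text \<open>At \<open>X = q^m\<close>, \<open>Y = q^l\<close> both products in
  \<open>W_telescope\<close> vanish, so \<open>W\<close> vanishes unless \<open>q X = Y\<close>. The
  excluded case \<open>Suc m = l\<close> is the jump on the diagonal.\<close>

lemma G_step:
  assumes "Suc m < n" "1 \<le> l" "l < n" "Suc m \<noteq> l"
  shows "(1 - q ^ Suc m) * G (q ^ Suc m) (q ^ l) = (1 - q ^ m) * G (q ^ m) (q ^ l)"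
proof -
  have 0: "(\<Prod>j<n - 1. q ^ m - q ^ j) = 0" "(\<Prod>j\<in>{1..<n}. q ^ l - q ^ j) = 0"
    using assms by (intro prod_zero bexI[of _ m] bexI[of _ l]; simp)+
  then have "W (q ^ m) (q ^ l) * (q ^ Suc m - q ^ l) = 0"
    using W_telescope[of "q ^ m" "q ^ l"] unfolding 0 by simp
  moreover have "q ^ Suc m \<noteq> q ^ l"
    using assms q_power_inj[of "Suc m" l] by auto
  ultimately have "W (q ^ m) (q ^ l) = 0"
    by simp
  then show ?thesis
    using G_shift[of "q ^ m" "q ^ l"] by simp
qed

lemma node: "1 + node m * t = q ^ m"
  using t_nz by (simp add: node_def)

lemma node_u: "1 \<le> l \<Longrightarrow> l < n \<Longrightarrow> node l * u l = - 1"
  using q_neq[of l] t_nz by (simp add: node_def u_def field_simps)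

lemma node_power_n: "(1 + node m * t) ^ n = 1"
  by (simp add: node power_mult[symmetric] mult.commute[of m n]) (simp add: power_mult qn)

text \<open>At a common node only the summand \<open>k = l\<close> survives, and the remaining product is the derivative
  of \<open>((1 + x t)\<^sup>n - 1) / (n t x)\<close> there, up to a factor.\<close>

lemma F_diag:
  assumes l: "1 \<le> l" "l < n"
  shows "F (node l) (node l) = - 1 / node l ^ 2"
proof -
  let ?x = "node l"
  define H where "H = (\<Prod>j\<in>{1..<n}. [:1, u j:])"
  define R where "R = (\<Prod>j\<in>{1..<n} - {l}. [:1, u j:])"
  have H: "H = [:1, u l:] * R"
    unfolding H_def R_def by (rule prod.remove) (use l in auto)
  have xu: "1 + ?x * u l = 0"
    using node_u[OF l] by simp
  have x0: "?x \<noteq> 0"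
    using xu by auto
  have "pderiv ([:0, of_nat n * t:] * H) = pderiv ([:1, t:] ^ n - 1)"
    unfolding H_def by (simp only: prod_u_poly)
  then have "poly (pderiv ([:0, of_nat n * t:] * H)) ?x = poly (pderiv ([:1, t:] ^ n - 1)) ?x"
    by (rule arg_cong)
  moreover have "poly H ?x = 0" "poly (pderiv H) ?x = u l * poly R ?x"
    unfolding H pderiv_mult using xu by (simp_all add: pderiv_pCons del: mult_pCons_left)
  ultimately have "of_nat n * t * ?x * (u l * poly R ?x) = of_nat n * (1 + ?x * t) ^ (n - 1) * t"
    by (simp add: pderiv_mult pderiv_pCons pderiv_smult pderiv_diff pderiv_power mult_ac del: mult_pCons_left)
  then have "(?x * u l) * poly R ?x = (1 + ?x * t) ^ (n - 1)"
    using n2 t_nz by (simp add: mult_ac)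
  then have "- poly R ?x = (q ^ l) ^ (n - 1)"
    using node_u[OF l] by (simp add: node)
  then have R: "poly R ?x = - ((q ^ l) ^ (n - 1))"
    by (metis minus_minus)
  have zero: "(\<Prod>j\<in>{1..<k}. 1 + ?x * u j) * v k * (\<Prod>j\<in>{Suc k..<n}. 1 + ?x * u j) = 0"
    if "k \<in> {1..<n} - {l}" for k
  proof (cases "l < k")
    case True
    then have "(\<Prod>j\<in>{1..<k}. 1 + ?x * u j) = 0"
      using l xu by (intro prod_zero) auto
    then show ?thesis by simp
  next
    case False
    then have "(\<Prod>j\<in>{Suc k..<n}. 1 + ?x * u j) = 0"
      using l xu that by (intro prod_zero) (auto intro!: bexI[of _ l])
    then show ?thesis by simp
  qed
  have "F ?x ?x = (\<Sum>k\<in>{l}. (\<Prod>j\<in>{1..<k}. 1 + ?x * u j) * v k * (\<Prod>j\<in>{Suc k..<n}. 1 + ?x * u j))"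
    unfolding F_def
    by (rule sum.mono_neutral_right[OF finite_atLeastLessThan _ ballI[OF zero]]) (use l in auto)
  also have "\<dots> = (\<Prod>j\<in>{1..<l}. 1 + ?x * u j) * v l * (\<Prod>j\<in>{Suc l..<n}. 1 + ?x * u j)"
    by simp
  also have "\<dots> = v l * poly R ?x"
  proof -
    have "{1..<n} - {l} = {1..<l} \<union> {Suc l..<n}"
      using l by auto
    then have "poly R ?x = (\<Prod>j\<in>{1..<l}. 1 + ?x * u j) * (\<Prod>j\<in>{Suc l..<n}. 1 + ?x * u j)"
      unfolding R_def poly_prod by (subst prod.union_disjoint[symmetric]) auto
    then show ?thesis by simp
  qed
  also have "\<dots> = - (u l ^ 2) * (q ^ l) ^ Suc (n - 1)"
    by (simp add: R v_def)
  also have "(q ^ l) ^ Suc (n - 1) = 1"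
    using node_power_n[of l] n2 by (simp add: node)
  also have "u l = - 1 / ?x"
    using node_u[OF l] x0 by (simp add: field_simps)
  finally show ?thesis
    by (simp add: power_divide)
qed

lemma node_nz: "1 \<le> l \<Longrightarrow> l < n \<Longrightarrow> node l \<noteq> 0"
  using node_u[of l] by auto

text \<open>The invariant \<open>(1 - X) G\<close> is 0 at \<open>X = q^0 = 1\<close>, and below the
  diagonal no step meets the jump.\<close>

lemma F_node_less:
  assumes "m < l" "l < n" "1 \<le> m"
  shows "F (node m) (node l) = 0"
proof -
  have "(1 - q ^ m) * G (q ^ m) (q ^ l) = 0"
    using assms(1)
  proof (induction m)
    case (Suc m)
    then show ?case
      using G_step[of m l] assms(2) by simp
  qed simp
  then show ?thesis
    using q_neq[of m] assms by (simp add: F_eq_G node)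
qed

text \<open>The invariant \<open>(1 - X) G\<close> is carried upwards from the diagonal value in
  \<open>F_diag\<close>.\<close>

lemma F_node_ge:
  assumes "l \<le> m" "m < n" "1 \<le> l"
  shows "F (node m) (node l) = - 1 / (node m * node l)"
proof -
  have "(1 - q ^ m) * G (q ^ m) (q ^ l) = (1 - q ^ l) * G (q ^ l) (q ^ l)"
    using assms(1,2)
  proof (induction m rule: dec_induct)
    case (step m)
    then show ?case
      using G_step[of m l] assms(3) by simp
  qed simp
  then have "node m * F (node m) (node l) = node l * F (node l) (node l)"
    using t_nz by (simp add: F_eq_G node) (simp add: node_def field_simps)
  also have "\<dots> = - 1 / node l"
    using assms node_nz[of l] by (subst F_diag) (auto simp: power2_eq_square)
  finally show ?thesis
    using assms node_nz[of l] node_nz[of m] by (simp add: field_simps)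
qed

section \<open>Coefficients of the generating function and interpolation at the nodes\<close>

definition Fcoeff where
  "Fcoeff a b = (\<Sum>k\<in>{1..<n}. esym u {1..<k} a * v k * esym u {Suc k..<n} b)"

lemma prod_eq_sum_esym:
  assumes "finite S" "card S < N"
  shows "(\<Prod>j\<in>S. 1 + x * u j) = (\<Sum>a<N. esym u S a * x ^ a)"
proof -
  have "degree (\<Prod>j\<in>S. [:1, u j:]) \<le> (\<Sum>j\<in>S. degree [:1, u j:])"
    using degree_prod_sum_le[OF assms(1), of "\<lambda>j. [:1, u j:]"] by (simp add: comp_def)
  also have "\<dots> \<le> (\<Sum>j\<in>S. 1)"
    by (intro sum_mono) auto
  finally have "degree (\<Prod>j\<in>S. [:1, u j:]) < N"
    using assms(2) by simp
  then show ?thesis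
    using poly_eq_sum_coeff[of "\<Prod>j\<in>S. [:1, u j:]" N x] by (simp add: poly_prod esym_def)
qed

text \<open>Omitting the index \<open>k\<close> leaves at most \<open>n - 2\<close> factors in each
  product, so \<open>n - 1\<close> nodes per variable determine \<open>F\<close>.\<close>

lemma F_eq_sum_Fcoeff: "F x y = (\<Sum>a<n - 1. \<Sum>b<n - 1. Fcoeff a b * x ^ a * y ^ b)"
proof -
  have "F x y = (\<Sum>k\<in>{1..<n}. (\<Sum>a<n - 1. esym u {1..<k} a * x ^ a) * v k *
      (\<Sum>b<n - 1. esym u {Suc k..<n} b * y ^ b))"
    unfolding F_def by (intro sum.cong refl arg_cong2[of _ _ _ _ "(*)"] prod_eq_sum_esym) auto
  also have "\<dots> = (\<Sum>k\<in>{1..<n}. \<Sum>a<n - 1. \<Sum>b<n - 1.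
      esym u {1..<k} a * v k * esym u {Suc k..<n} b * x ^ a * y ^ b)"
    by (simp only: sum_distrib_left sum_distrib_right mult_ac)
  also have "\<dots> = (\<Sum>a<n - 1. \<Sum>b<n - 1. \<Sum>k\<in>{1..<n}.
      esym u {1..<k} a * v k * esym u {Suc k..<n} b * x ^ a * y ^ b)"
    by (subst sum.swap) (rule sum.cong[OF refl], rule sum.swap)
  finally show ?thesis
    by (simp only: Fcoeff_def sum_distrib_right)
qed

text \<open>The polynomial \<open>Q\<close> is chosen such that its divided difference \<open>DD\<close> agrees with
  \<open>- (F x y + F y x)\<close> at all pairs of nodes; \<open>Q_identity\<close> determines its value and its derivative
  at the nodes.\<close>

definition d where "d i = t ^ Suc i * of_nat (Suc n choose (i + 2)) / of_nat n"

definition Q where "Q = (\<Sum>i<n. monom (d i) i)"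

definition DD where "DD x y = (\<Sum>a<n - 1. \<Sum>b<n - 1. d (Suc (a + b)) * x ^ a * y ^ b)"

lemma d_eq_0: "n \<le> i \<Longrightarrow> d i = 0"
  by (simp add: d_def binomial_eq_0)

lemma coeff_Q: "coeff Q i = d i"
  using d_eq_0[of i] by (simp add: Q_def coeff_sum)

lemma poly_Q: "poly Q x = (\<Sum>i<n. d i * x ^ i)"
  by (simp add: Q_def poly_sum poly_monom)

lemma Q_identity:
  "[:0, 0, of_nat n * t:] * Q = [:1, t:] ^ Suc n - [:1, of_nat (Suc n) * t:]"
proof (rule poly_eqI)
  fix i
  consider "i = 0" | "i = 1" | i' where "i = Suc (Suc i')"
    by (metis One_nat_def old.nat.exhaust)
  then show "coeff ([:0, 0, of_nat n * t:] * Q) i =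
      coeff ([:1, t:] ^ Suc n - [:1, of_nat (Suc n) * t:]) i"
  proof cases
    case 3
    then show ?thesis
      using n2 by (simp only: coeff_diff coeff_one_plus_power) (simp add: coeff_Q d_def)
  qed (simp_all only: coeff_diff coeff_one_plus_power, simp_all)
qed

text \<open>Since \<open>(1 + x t)^n = 1\<close> at a node, the right side of
  \<open>Q_identity\<close> takes the value \<open>- n t x\<close> there and its derivative is
  0.\<close>

lemma poly_Q_node:
  assumes "1 \<le> l" "l < n"
  shows "poly Q (node l) = - 1 / node l"
    and "poly (pderiv Q) (node l) = 2 / node l ^ 2"
proof -
  let ?x = "node l"
  let ?c = "of_nat n * t"
  have c: "?c \<noteq> 0" and x: "?x \<noteq> 0"
    using n2 t_nz node_nz[OF assms] by auto
  have "poly ([:0, 0, ?c:] * Q) ?x = poly ([:1, t:] ^ Suc n - [:1, of_nat (Suc n) * t:]) ?x"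
    by (simp only: Q_identity)
  then have "?x * (?x * ?c) * poly Q ?x = (1 + ?x * t) - 1 - of_nat (Suc n) * t * ?x"
    using node_power_n[of l] by (simp add: mult_ac)
  also have "\<dots> = - (?x * ?c)"
    by (simp add: algebra_simps)
  finally have "(?x * ?c) * (?x * poly Q ?x + 1) = 0"
    unfolding distrib_left by (simp add: mult_ac)
  then have "?x * poly Q ?x = - 1"
    using c x by (simp add: eq_neg_iff_add_eq_0)
  then show 1: "poly Q ?x = - 1 / ?x"
    using x by (simp add: field_simps)
  have "poly (pderiv ([:0, 0, ?c:] * Q)) ?x =
      poly (pderiv ([:1, t:] ^ Suc n - [:1, of_nat (Suc n) * t:])) ?x"
    by (simp only: Q_identity)
  then have "?x * (?x * ?c) * poly (pderiv Q) ?x + 2 * (?x * ?c) * poly Q ?x = 0"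
    unfolding pderiv_mult pderiv_diff pderiv_power_Suc using node_power_n[of l]
    by (simp add: pderiv_pCons algebra_simps)
  then have "(?x * ?c) * (?x * poly (pderiv Q) ?x + 2 * poly Q ?x) = 0"
    by (simp add: algebra_simps)
  then have "?x * poly (pderiv Q) ?x = 2 / ?x"
    using c x by (simp add: 1 field_simps)
  then show "poly (pderiv Q) ?x = 2 / ?x ^ 2"
    using x by (simp add: field_simps power2_eq_square)
qed

text \<open>\<open>(x^i - y^i) / (x - y)\<close> is the sum of all monomials of total degree
  \<open>i - 1\<close>. As \<open>d i = 0\<close> for \<open>i >= n\<close>, the square range of
  exponents in \<open>DD\<close> contains them all.\<close>

lemma DD_divided_difference: "(x - y) * DD x y = poly Q x - poly Q y"
proof -
  define N where "N = n - 1"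
  define E where "E = (\<lambda>a b. d (a + b) * x ^ a * y ^ b)"
  have n: "n = Suc N"
    using n2 by (simp add: N_def)
  \<comment> \<open>On the far edges of the square only the corners \<open>(N, 0)\<close> and
    \<open>(0, N)\<close> survive the telescoping.\<close>
  have E_N: "E N a = 0" "E a N = 0" if "a \<noteq> 0" for a
  proof -
    have "n \<le> N + a" "n \<le> a + N"
      using that n2 unfolding N_def by linarith+
    then show "E N a = 0" "E a N = 0"
      by (simp_all only: E_def d_eq_0) simp_all
  qed
  have split: "(\<Sum>i<n. f i) = (\<Sum>i<N. f i) + f N" for f :: "nat \<Rightarrow> complex"
    unfolding n by simp
  have N: "0 < N"
    using n2 by (simp add: N_def)
  have shift: "(\<Sum>a<N. f (Suc a)) = (\<Sum>a<N. f a) + f N - f 0" for f :: "nat \<Rightarrow> complex"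
    by (induction N) simp_all
  have "(x - y) * DD x y = (\<Sum>a<N. \<Sum>b<N. E (Suc a) b - E a (Suc b))"
    unfolding DD_def sum_distrib_left N_def[symmetric]
    by (intro sum.cong refl) (simp add: E_def algebra_simps)
  also have "\<dots> = (\<Sum>b<N. \<Sum>a<N. E (Suc a) b) - (\<Sum>a<N. \<Sum>b<N. E a (Suc b))"
    by (simp only: sum_subtractf) (simp only: sum.swap[of "\<lambda>a b. E (Suc a) b"])
  also have "\<dots> = (\<Sum>b<N. (\<Sum>a<N. E a b) + E N b - E 0 b) -
      (\<Sum>a<N. (\<Sum>b<N. E a b) + E a N - E a 0)"
    by (simp only: shift[of "\<lambda>a. E a _"] shift[of "\<lambda>b. E _ b"])
  also have "\<dots> = ((\<Sum>b<N. E N b) - (\<Sum>b<N. E 0 b)) - ((\<Sum>a<N. E a N) - (\<Sum>a<N. E a 0))"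
    using sum.swap[of E "{..<N}" "{..<N}"] by (simp add: sum.distrib sum_subtractf)
  also have "(\<Sum>b<N. E N b) = d N * x ^ N"
    by (subst sum.remove[of _ 0]) (use N E_N in auto, simp add: E_def)
  also have "(\<Sum>a<N. E a N) = d N * y ^ N"
    by (subst sum.remove[of _ 0]) (use N E_N in auto, simp add: E_def)
  also have "d N * x ^ N - (\<Sum>b<N. E 0 b) - (d N * y ^ N - (\<Sum>a<N. E a 0)) = poly Q x - poly Q y"
    by (simp add: poly_Q split E_def)
  finally show ?thesis .
qed

text \<open>For fixed \<open>y\<close>, \<open>DD\<close> is a polynomial \<open>P\<close> in
  \<open>x\<close> with \<open>(x - y) P = Q - Q(y)\<close>; differentiating at \<open>x = y\<close>
  gives the value.\<close>

lemma DD_diag: "DD y y = poly (pderiv Q) y"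
proof -
  define P where "P = (\<Sum>a<n - 1. monom (\<Sum>b<n - 1. d (Suc (a + b)) * y ^ b) a)"
  have P: "poly P x = DD x y" for x
    by (simp add: P_def DD_def poly_sum poly_monom sum_distrib_left sum_distrib_right mult_ac)
  have "[:- y, 1:] * P = Q - [:poly Q y:]"
  proof (rule poly_ext)
    fix x
    show "poly ([:- y, 1:] * P) x = poly (Q - [:poly Q y:]) x"
      using DD_divided_difference[of x y] by (simp add: P algebra_simps)
  qed
  then have "poly (pderiv ([:- y, 1:] * P)) y = poly (pderiv (Q - [:poly Q y:])) y"
    by (simp only:)
  then show ?thesis
    unfolding pderiv_mult pderiv_diff by (simp add: pderiv_pCons P)
qed

text \<open>Off the diagonal one of the two values of \<open>F\<close> is 0 and the other is
  \<open>- 1 / (x y)\<close>, while \<open>Q x - Q y = (x - y) / (x y)\<close>. On the diagonal both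
  sides are \<open>- 2 / x^2\<close>.\<close>

lemma F_symmetrized_node:
  assumes "m \<in> {1..<n}" "l \<in> {1..<n}"
  shows "F (node m) (node l) + F (node l) (node m) = - DD (node m) (node l)"
proof -
  have nz: "node m \<noteq> 0" "node l \<noteq> 0"
    using assms node_nz by auto
  show ?thesis
  proof (cases "m = l")
    case True
    then show ?thesis
      using assms by (simp add: DD_diag poly_Q_node F_diag)
  next
    case False
    have "F (node m) (node l) + F (node l) (node m) = - 1 / (node m * node l)"
      using False assms
      by (cases m l rule: linorder_cases) (auto simp: F_node_less F_node_ge mult.commute)
    moreover have "node m \<noteq> node l"
      using False assms q_power_inj[of m l] t_nz by (auto simp: node_def)
    moreover have "(node m - node l) * DD (node m) (node l) = (node m - node l) * (1 / (node m * node l))"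
      unfolding DD_divided_difference using assms nz by (simp add: poly_Q_node field_simps)
    ultimately show ?thesis
      by (metis mult_cancel_left right_minus_eq minus_divide_left)
  qed
qed

lemma Fcoeff_symmetrized:
  assumes "a < n - 1" "b < n - 1"
  shows "Fcoeff a b + Fcoeff b a = - (t ^ (a + b + 2) * of_nat (Suc n choose (a + b + 3)) / of_nat n)"
proof -
  have "Fcoeff a b + Fcoeff b a + d (Suc (a + b)) = 0"
  proof (rule double_sum_powers_eq_0_imp_coeff_eq_0[where N = "n - 1" and S = "node ` {1..<n}"
        and c = "\<lambda>a b. Fcoeff a b + Fcoeff b a + d (Suc (a + b))"])
    have "inj_on node {1..<n}"
      using t_nz by (auto intro!: inj_onI q_power_inj simp: node_def)
    then show "n - 1 \<le> card (node ` {1..<n})"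
      by (simp add: card_image)
    fix x y assume "x \<in> node ` {1..<n}" "y \<in> node ` {1..<n}"
    then have "F x y + F y x + DD x y = 0"
      using F_symmetrized_node by force
    moreover have "F y x = (\<Sum>a<n - 1. \<Sum>b<n - 1. Fcoeff b a * x ^ a * y ^ b)"
      unfolding F_eq_sum_Fcoeff by (subst sum.swap) (simp only: mult_ac)
    ultimately show "(\<Sum>a<n - 1. \<Sum>b<n - 1.
        (Fcoeff a b + Fcoeff b a + d (Suc (a + b))) * x ^ a * y ^ b) = 0"
      unfolding DD_def F_eq_sum_Fcoeff[of x y] by (simp only: distrib_right sum.distrib)
  qed (use assms in auto)
  then show ?thesis
    by (simp add: d_def eq_neg_iff_add_eq_0 numeral_eq_Suc)
qed

end

section \<open>Reflection and the second identity for finite \<open>n\<close>\<close>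

context primitive_root
begin

lemma power_reflect: "j \<le> n \<Longrightarrow> q ^ (n - j) = 1 / q ^ j"
  using qn q_nz by (simp add: power_diff)

lemma u_reflect: "1 \<le> j \<Longrightarrow> j < n \<Longrightarrow> u (n - j) = t - u j"
  using q_neq[of j] q_nz by (simp add: u_def power_reflect field_simps)

lemma zn_weight_eq: "zn_weight q s j = (q ^ j) ^ (s - 1) * u j ^ s"
  by (simp add: zn_weight_def u_eq power_one_over mult.commute flip: power_mult)

lemma norm_q: "norm q = 1"
proof -
  have "norm q ^ n = 1"
    using qn by (simp flip: norm_power)
  then show ?thesis
    using n2 power_eq_1_iff by force
qed

lemma norm_u_reflect:
  assumes "1 \<le> j" "j < n"
  shows "norm (u (n - j)) = norm (u j)"
proof -
  have "u (n - j) = - (q ^ j * u j)"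
    using assms q_neq[of j] q_nz by (simp add: u_def power_reflect field_simps)
  then show ?thesis
    by (simp add: norm_mult norm_power norm_q)
qed

lemma norm_zn_weight: "norm (zn_weight q s j) = norm (u j) ^ s"
  by (simp add: zn_weight_eq norm_mult norm_power norm_q)

lemma zn_weight_2_reflect: "1 \<le> j \<Longrightarrow> j < n \<Longrightarrow> zn_weight q 2 (n - j) = zn_weight q 2 j"
  using q_neq[of j] q_nz
  by (simp add: zn_weight_eq u_def power_reflect field_simps power2_eq_square)

text \<open>With \<open>z = q^j\<close> the two weights are \<open>z^2 u^3\<close> and
  \<open>- z u^3\<close>, and \<open>u (1 - z) = t\<close> trades one power of \<open>u\<close> for
  the small factor \<open>t\<close>.\<close>

lemma zn_weight_3_reflect:
  assumes "1 \<le> j" "j < n"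
  shows "zn_weight q 3 j + zn_weight q 3 (n - j) = - t * zn_weight q 2 j"
proof -
  define z where "z = q ^ j"
  have z: "z \<noteq> 0" "z \<noteq> 1"
    using q_neq[OF assms] q_nz by (auto simp: z_def)
  have u: "u (n - j) = - (z * u j)" "t = u j * (1 - z)"
    using assms q_neq[of j] q_nz by (simp_all add: z_def u_def power_reflect field_simps)
  show ?thesis
    unfolding zn_weight_eq u(1) power_reflect[OF less_imp_le[OF assms(2)]] z_def[symmetric] u(2)
    using z by (simp add: field_simps power2_eq_square power3_eq_cube)
qed

text \<open>Reflecting the first sum swaps the functions below and above \<open>k\<close>, because
  the weights for the entry 2 are symmetric. The two sums then differ only in the middle weight, and
  \<open>zn_weight_3_reflect\<close> applies.\<close>

lemma mid_sum_3_symmetrized: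
  "(\<Sum>k\<in>{1..<n}. esym (zn_weight q 2) {1..<k} a * zn_weight q 3 k * esym (zn_weight q 2) {Suc k..<n} b) +
   (\<Sum>k\<in>{1..<n}. esym (zn_weight q 2) {1..<k} b * zn_weight q 3 k * esym (zn_weight q 2) {Suc k..<n} a) =
   - t * (\<Sum>k\<in>{1..<n}. esym (zn_weight q 2) {1..<k} b * zn_weight q 2 k * esym (zn_weight q 2) {Suc k..<n} a)"
proof -
  let ?e = "esym (zn_weight q 2)"
  have reflect: "?e {l..<h} m = ?e {Suc n - h..<Suc n - l} m" if "1 \<le> l" "h \<le> n" for l h m
  proof -
    have "?e {l..<h} m = esym (\<lambda>j. zn_weight q 2 (n - j)) {l..<h} m"
      using that by (intro esym_cong zn_weight_2_reflect[symmetric]) auto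
    then show ?thesis
      using that by (simp add: esym_reflect)
  qed
  have "(\<Sum>k\<in>{1..<n}. ?e {1..<k} a * zn_weight q 3 k * ?e {Suc k..<n} b) =
      (\<Sum>k\<in>{1..<n}. ?e {1..<n - k} a * zn_weight q 3 (n - k) * ?e {Suc (n - k)..<n} b)"
    by (rule sum_reflect[symmetric])
  also have "\<dots> = (\<Sum>k\<in>{1..<n}. ?e {1..<k} b * zn_weight q 3 (n - k) * ?e {Suc k..<n} a)"
  proof (rule sum.cong[OF refl])
    fix k assume k: "k \<in> {1..<n}"
    have "?e {1..<n - k} a = ?e {Suc k..<n} a" "?e {Suc (n - k)..<n} b = ?e {1..<k} b"
      using k reflect[of "Suc k" n a] reflect[of 1 k b] by (auto simp: Suc_diff_le)
    then show "?e {1..<n - k} a * zn_weight q 3 (n - k) * ?e {Suc (n - k)..<n} b =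
        ?e {1..<k} b * zn_weight q 3 (n - k) * ?e {Suc k..<n} a"
      by (simp only: mult_ac)
  qed
  finally have "(\<Sum>k\<in>{1..<n}. ?e {1..<k} a * zn_weight q 3 k * ?e {Suc k..<n} b) +
      (\<Sum>k\<in>{1..<n}. ?e {1..<k} b * zn_weight q 3 k * ?e {Suc k..<n} a) =
      (\<Sum>k\<in>{1..<n}. ?e {1..<k} b * (zn_weight q 3 k + zn_weight q 3 (n - k)) * ?e {Suc k..<n} a)"
    by (simp add: sum.distrib algebra_simps)
  also have "\<dots> = (\<Sum>k\<in>{1..<n}. - t * (?e {1..<k} b * zn_weight q 2 k * ?e {Suc k..<n} a))"
    by (rule sum.cong[OF refl]) (subst zn_weight_3_reflect, auto)
  finally show ?thesis
    by (simp only: sum_distrib_left)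
qed

end

section \<open>Passage to the limit\<close>

definition unit_root :: "nat \<Rightarrow> complex" where "unit_root n = exp (2 * of_real pi * \<i> / of_nat n)"

lemma primitive_root_unit_root:
  assumes "n \<ge> 2"
  shows "primitive_root n (unit_root n)"
proof
  have pow: "unit_root n ^ j = exp (2 * of_real pi * \<i> * of_nat j / of_nat n)" for j
    by (simp add: unit_root_def mult_ac flip: exp_of_nat_mult)
  show "unit_root n ^ n = 1"
    using assms unfolding pow by simp
  show "unit_root n ^ j \<noteq> 1" if "1 \<le> j" "j < n" for j
    using complex_root_unity_eq_1[of n j] that assms unfolding pow by (auto dest: dvd_imp_le)
qed fact

section \<open>Bounds and limits of the weights at \<open>exp(2 pi i / n)\<close>\<close>

lemma quarter_le_sin:
  fixes x :: real
  assumes "0 \<le> x" "x \<le> pi / 2"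
  shows "x / 4 \<le> sin x"
proof (cases "x = 0")
  case False
  then have x: "0 < x / 2" "x / 2 \<le> pi / 4"
    using assms by auto
  obtain z where z: "0 < z" "z < x / 2" "sin (x / 2) - sin 0 = (x / 2 - 0) * cos z"
    using MVT2[OF x(1), of sin cos] by (auto intro: derivative_eq_intros)
  have cos: "1 / 2 \<le> cos y" if "0 \<le> y" "y \<le> pi / 4" for y
    using cos_monotone_0_pi_le[of y "pi / 3"] that pi_gt_zero by (simp add: cos_60)
  have "x / 2 * (1 / 2) \<le> x / 2 * cos z"
    using z x cos[of z] by (intro mult_left_mono) auto
  then have "x / 2 * (1 / 2) \<le> sin (x / 2)"
    using z(3) by simp
  then have "2 * (x / 2 * (1 / 2) * (1 / 2)) \<le> 2 * (sin (x / 2) * cos (x / 2))"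
    using x cos[of "x / 2"] by (intro mult_left_mono mult_mono) auto
  also have "\<dots> = sin x"
    using sin_double[of "x / 2"] by simp
  finally show ?thesis
    by simp
qed simp

lemma norm_one_minus_root_power:
  "norm (1 - unit_root n ^ j) = 2 * \<bar>sin (pi * real j / real n)\<bar>"
proof -
  have "unit_root n ^ j = exp (\<i> * of_real (2 * (pi * real j / real n)))"
    by (simp add: unit_root_def mult_ac flip: exp_of_nat_mult)
  then show ?thesis
    using dist_exp_i_1[of "2 * (pi * real j / real n)"] by (simp add: norm_minus_commute)
qed

lemma norm_u_root_le:
  assumes "1 \<le> j" "2 * j \<le> n"
  shows "norm (primitive_root.u (unit_root n) j) \<le> 4 / real j"
proof -
  interpret primitive_root n "unit_root n"
    by (rule primitive_root_unit_root) (use assms in linarith)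
  \<comment> \<open>Half the argument of \<open>q^j\<close>; the hypothesis
    \<open>2 * j <= n\<close> places it in \<open>(0, pi/2]\<close>, where the sine has a linear
    lower bound.\<close>
  define x where "x = pi * real j / real n"
  have x: "0 < x" "x \<le> pi / 2"
    using assms by (auto simp: x_def field_simps)
  have "norm (1 - unit_root n) \<le> 2 * (pi / real n)"
    using norm_one_minus_root_power[of n 1] abs_sin_x_le_abs_x[of "pi / real n"] by simp
  moreover have "x / 2 \<le> norm (1 - unit_root n ^ j)"
    using quarter_le_sin[of x] x by (simp add: norm_one_minus_root_power x_def[symmetric])
  ultimately have "norm (u j) \<le> 2 * (pi / real n) / (x / 2)"
    unfolding u_def t_def norm_divide using x by (intro frac_le) auto
  also have "\<dots> = 4 / real j"
    using assms by (simp add: x_def field_simps)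
  finally show ?thesis .
qed

lemma norm_zn_weight_root_le:
  assumes "1 \<le> j" "2 * j \<le> n"
  shows "norm (zn_weight (unit_root n) s j) \<le> (4 / real j) ^ s"
    and "norm (zn_weight (unit_root n) s (n - j)) \<le> (4 / real j) ^ s"
proof -
  interpret primitive_root n "unit_root n"
    by (rule primitive_root_unit_root) (use assms in linarith)
  show "norm (zn_weight (unit_root n) s j) \<le> (4 / real j) ^ s"
    using norm_u_root_le[OF assms] by (simp add: norm_zn_weight power_mono)
  show "norm (zn_weight (unit_root n) s (n - j)) \<le> (4 / real j) ^ s"
    using norm_u_root_le[OF assms] assms by (simp add: norm_zn_weight norm_u_reflect power_mono)
qed

lemma of_nat_mult_one_minus_root:
  "(\<lambda>n. of_nat n * (1 - unit_root n)) \<longlonglongrightarrow> - 2 * of_real pi * \<i>"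
proof -
  define c where "c = 2 * of_real pi * \<i>"
  have c: "c \<noteq> 0"
    by (simp add: c_def)
  have "(\<lambda>n. c / of_nat n) \<longlonglongrightarrow> 0"
    by (rule lim_const_over_n)
  then have "filterlim (\<lambda>n. c / of_nat n) (at 0) sequentially"
    unfolding filterlim_at using c
    by (auto intro: eventually_mono[OF eventually_gt_at_top[of 0]])
  from filterlim_compose[OF lim_exp_minus_1 this]
  have "(\<lambda>n. - c * ((exp (c / of_nat n) - 1) / (c / of_nat n))) \<longlonglongrightarrow> - c * 1"
    by (intro tendsto_mult tendsto_const)
  moreover have "- c * ((exp (c / of_nat n) - 1) / (c / of_nat n)) = of_nat n * (1 - unit_root n)" for n
    using c by (cases "n = 0") (simp_all add: unit_root_def c_def field_simps)
  ultimately show ?thesis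
    by (simp add: c_def)
qed

lemma unit_root_tendsto: "unit_root \<longlonglongrightarrow> 1"
proof -
  have "(\<lambda>n. exp (2 * of_real pi * \<i> / of_nat n)) \<longlonglongrightarrow> exp 0"
    by (intro tendsto_exp lim_const_over_n)
  then show ?thesis
    by (simp add: unit_root_def[abs_def])
qed

lemma inverse_q_number_tendsto:
  assumes "1 \<le> j"
  shows "(\<lambda>n. 1 / q_number (unit_root n) j) \<longlonglongrightarrow> 1 / of_nat j"
proof -
  have "(\<lambda>n. 1 / q_number (unit_root n) j) \<longlonglongrightarrow> 1 / (\<Sum>i<j. 1 ^ i)"
    unfolding q_number_def using assms by (intro tendsto_intros unit_root_tendsto) auto
  then show ?thesis
    by simp
qed

lemma convergent_zn_weight_root:
  assumes "1 \<le> j"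
  shows "convergent (\<lambda>n. zn_weight (unit_root n) s j)"
    and "convergent (\<lambda>n. zn_weight (unit_root n) s (n - j))"
proof -
  have "(\<lambda>n. unit_root n ^ ((s - 1) * j) * (1 / q_number (unit_root n) j) ^ s)
      \<longlonglongrightarrow> 1 ^ ((s - 1) * j) * (1 / of_nat j) ^ s"
    using assms by (intro tendsto_mult tendsto_power inverse_q_number_tendsto unit_root_tendsto)
  then have "convergent (\<lambda>n. unit_root n ^ ((s - 1) * j) * (1 / q_number (unit_root n) j) ^ s)"
    by (rule convergentI)
  then show "convergent (\<lambda>n. zn_weight (unit_root n) s j)"
    by (simp add: zn_weight_def power_one_over)
  \<comment> \<open>The weight at \<open>n - j\<close> is rewritten by
    \<open>q^(n-j) = 1 / q^j\<close> and \<open>u (n - j) = t - u j\<close>, so that only the fixed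
    index \<open>j\<close> occurs.\<close>
  have "(\<lambda>n. (1 / unit_root n ^ j) ^ (s - 1) * ((1 - unit_root n) - 1 / q_number (unit_root n) j) ^ s)
      \<longlonglongrightarrow> (1 / 1 ^ j) ^ (s - 1) * ((1 - 1) - 1 / of_nat j) ^ s"
    using assms
    by (intro tendsto_mult tendsto_power tendsto_diff tendsto_const tendsto_divide[where a = 1]
        inverse_q_number_tendsto unit_root_tendsto) auto
  moreover have "\<forall>\<^sub>F n in sequentially. (1 / unit_root n ^ j) ^ (s - 1) *
      ((1 - unit_root n) - 1 / q_number (unit_root n) j) ^ s = zn_weight (unit_root n) s (n - j)"
    using eventually_gt_at_top[of "2 * j"]
  proof eventually_elim
    case (elim n)
    interpret primitive_root n "unit_root n"
      by (rule primitive_root_unit_root) (use elim assms in linarith)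
    have u: "u (n - j) = (1 - unit_root n) - 1 / q_number (unit_root n) j"
      using u_reflect[of j] u_eq[of j] elim assms by (simp add: t_def)
    have "j \<le> n"
      using elim by simp
    then show ?case
      by (simp only: zn_weight_eq power_reflect u)
  qed
  ultimately have "(\<lambda>n. zn_weight (unit_root n) s (n - j))
      \<longlonglongrightarrow> (1 / 1 ^ j) ^ (s - 1) * ((1 - 1) - 1 / of_nat j) ^ s"
    by (rule Lim_transform_eventually)
  then show "convergent (\<lambda>n. zn_weight (unit_root n) s (n - j))"
    by (rule convergentI)
qed

lemma convergent_mid_sum_root:
  assumes cd: "c \<in> {1..3}" "d \<in> {2..3}"
    and e: "\<And>i. i \<le> max a b \<Longrightarrow> convergent (\<lambda>n. esym (zn_weight (unit_root n) c) {1..<n} i)"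
  shows "convergent (\<lambda>n. \<Sum>k\<in>{1..<n}. esym (zn_weight (unit_root n) c) {1..<k} a *
    zn_weight (unit_root n) d k * esym (zn_weight (unit_root n) c) {Suc k..<n} b)"
proof -
  have le: "(4 / real j) ^ s \<le> 64 / real j ^ r" if "1 \<le> j" "s \<le> 3" "r \<le> s" for j s r
  proof -
    have "(4 :: real) ^ s \<le> 4 ^ 3"
      using that by (intro power_increasing) auto
    moreover have "real j ^ r \<le> real j ^ s"
      using that by (intro power_increasing) auto
    ultimately show ?thesis
      unfolding power_divide using that by (intro frac_le) auto
  qed
  show ?thesis
  \<comment> \<open>\<open>64 = 4^3\<close> covers all exponents up to 3, and \<open>d >= 2\<close>
    supplies the decay \<open>1 / j^2\<close> of the middle weight.\<close>
  proof (rule convergent_mid_sum[where C = 64])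
    fix n j :: nat
    assume j: "1 \<le> j" "2 * j \<le> n"
    show "norm (zn_weight (unit_root n) c j) \<le> 64 / real j" "norm (zn_weight (unit_root n) c (n - j)) \<le> 64 / real j"
      using norm_zn_weight_root_le[OF j, of c] le[OF j(1), of c 1] cd by auto
    show "norm (zn_weight (unit_root n) d j) \<le> 64 / real j ^ 2" "norm (zn_weight (unit_root n) d (n - j)) \<le> 64 / real j ^ 2"
      using norm_zn_weight_root_le[OF j, of d] le[OF j(1), of d 2] cd by auto
  qed (use e convergent_zn_weight_root in auto)
qed

lemma binomial_over_power_tendsto:
  "(\<lambda>n. of_nat ((n + p) choose k) / of_nat n ^ k :: complex) \<longlonglongrightarrow> 1 / fact k"
proof -
  have "(\<lambda>n. (\<Prod>i = 0..<k. (of_nat n + (of_nat p - of_nat i)) / of_nat n :: complex) / fact k)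
      \<longlonglongrightarrow> (\<Prod>i = 0..<k. 1) / fact k"
  proof (intro tendsto_divide tendsto_prod tendsto_const)
    fix i
    have "(\<lambda>n. 1 + (of_nat p - of_nat i) / of_nat n :: complex) \<longlonglongrightarrow> 1 + 0"
      by (intro tendsto_add tendsto_const lim_const_over_n)
    moreover have "\<forall>\<^sub>F n in sequentially. 1 + (of_nat p - of_nat i) / of_nat n =
        ((of_nat n + (of_nat p - of_nat i)) / of_nat n :: complex)"
      using eventually_gt_at_top[of 0] by eventually_elim (simp add: field_simps)
    ultimately show "(\<lambda>n. (of_nat n + (of_nat p - of_nat i)) / of_nat n :: complex) \<longlonglongrightarrow> 1"
      by (simp add: tendsto_cong)
  qed simp
  moreover have "(\<Prod>i = 0..<k. (of_nat n + (of_nat p - of_nat i)) / of_nat n) / fact k =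
      (of_nat ((n + p) choose k) / of_nat n ^ k :: complex)" for n
    by (simp add: binomial_gbinomial gbinomial_prod_rev prod_dividef add_diff_eq)
  ultimately show ?thesis
    by simp
qed

text \<open>The shift \<open>p\<close> is 0 for the full-range functions in
  \<open>esym_u_all\<close> and 1 for the binomial in \<open>Fcoeff_symmetrized\<close>.\<close>

lemma binomial_one_minus_root_tendsto:
  "(\<lambda>n. of_nat ((n + p) choose Suc m) * (1 - unit_root n) ^ m / of_nat n)
     \<longlonglongrightarrow> (- 2 * of_real pi * \<i>) ^ m / fact (Suc m)"
proof -
  have "(\<lambda>n. of_nat ((n + p) choose Suc m) / of_nat n ^ Suc m * (of_nat n * (1 - unit_root n)) ^ m)
      \<longlonglongrightarrow> 1 / fact (Suc m) * (- 2 * of_real pi * \<i>) ^ m"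
    by (intro tendsto_mult tendsto_power binomial_over_power_tendsto of_nat_mult_one_minus_root)
  moreover have "of_nat ((n + p) choose Suc m) / of_nat n ^ Suc m * (of_nat n * (1 - unit_root n)) ^ m =
      of_nat ((n + p) choose Suc m) * (1 - unit_root n) ^ m / of_nat n" for n
    by (cases "n = 0") (simp_all add: power_mult_distrib)
  ultimately show ?thesis
    by (simp add: mult.commute)
qed

lemma convergent_esym_1_root: "convergent (\<lambda>n. esym (zn_weight (unit_root n) 1) {1..<n} m)"
proof -
  have "convergent (\<lambda>n. of_nat ((n + 0) choose Suc m) * (1 - unit_root n) ^ m / of_nat n)"
    using binomial_one_minus_root_tendsto by (rule convergentI)
  moreover have "\<forall>\<^sub>F n in sequentially. of_nat ((n + 0) choose Suc m) * (1 - unit_root n) ^ m / of_nat n =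
      esym (zn_weight (unit_root n) 1) {1..<n} m"
    using eventually_ge_at_top[of 2]
  proof eventually_elim
    case (elim n)
    interpret primitive_root n "unit_root n"
      using elim by (rule primitive_root_unit_root)
    have "zn_weight (unit_root n) 1 = u"
      by (rule ext) (rule zn_weight_1)
    then show ?case
      using esym_u_all[of m] by (simp add: t_def)
  qed
  ultimately show ?thesis
    by (simp only: convergent_cong)
qed

text \<open>Grouping by the largest index gives a middle sum with \<open>b = 0\<close>, whose
  convergence requires only the degrees below \<open>m\<close>; hence the strong induction instead
  of a closed form.\<close>

lemma convergent_esym_2_root: "convergent (\<lambda>n. esym (zn_weight (unit_root n) 2) {1..<n} m)"
proof (induction m rule: less_induct)
  case (less m)
  show ?case
  proof (cases m)
    case 0
    then show ?thesis
      by (simp add: esym_0 convergent_const)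
  next
    case (Suc m')
    have "convergent (\<lambda>n. \<Sum>k\<in>{1..<n}. esym (zn_weight (unit_root n) 2) {1..<k} m' *
        zn_weight (unit_root n) 2 k * esym (zn_weight (unit_root n) 2) {Suc k..<n} 0)"
      using less Suc by (intro convergent_mid_sum_root) auto
    then show ?thesis
      by (simp add: Suc esym_0 esym_Suc_interval)
  qed
qed

lemma zn_tendsto_xi:
  assumes "c = 1 \<and> d = 2 \<or> c = 2 \<and> d = 3"
  shows "(\<lambda>n. zn n (replicate a c @ [d] @ replicate b c) (unit_root n))
    \<longlonglongrightarrow> xi (replicate a c @ [d] @ replicate b c)"
proof -
  have "convergent (\<lambda>n. zn n (replicate a c @ [d] @ replicate b c) (unit_root n))"
    unfolding zn_replicate_mid using assms convergent_esym_1_root convergent_esym_2_root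
    by (intro convergent_mid_sum_root) auto
  then show ?thesis
    by (simp add: convergent_LIMSEQ_iff xi_def unit_root_def)
qed

theorem corollary1p1:
  fixes a b :: nat
  shows "xi (replicate a 1 @ [2] @ replicate b 1) + xi (replicate b 1 @ [2] @ replicate a 1)
           = - ((- 2 * of_real pi * \<i>) ^ (a + b + 2) / fact (a + b + 3))
       \<and> xi (replicate a 2 @ [3] @ replicate b 2) + xi (replicate b 2 @ [3] @ replicate a 2) = 0"
proof
  have "\<forall>\<^sub>F n in sequentially. - (of_nat ((n + 1) choose Suc (a + b + 2)) *
        (1 - unit_root n) ^ (a + b + 2) / of_nat n) =
      zn n (replicate a 1 @ [2] @ replicate b 1) (unit_root n) + zn n (replicate b 1 @ [2] @ replicate a 1) (unit_root n)"
    \<comment> \<open>Large enough for \<open>n >= 2\<close> and for \<open>a\<close> and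
      \<open>b\<close> to lie below \<open>n - 1\<close>, as \<open>Fcoeff_symmetrized\<close>
      demands.\<close>
    using eventually_ge_at_top[of "a + b + 2"]
  proof eventually_elim
    case (elim n)
    interpret primitive_root n "unit_root n"
      by (rule primitive_root_unit_root) (use elim in linarith)
    have w: "zn_weight (unit_root n) 1 = u"
      by (rule ext) (rule zn_weight_1)
    have "zn n (replicate a 1 @ [2] @ replicate b 1) (unit_root n) = Fcoeff a b" for a b
      unfolding zn_replicate_mid w zn_weight_2 Fcoeff_def ..
    moreover have "a < n - 1" "b < n - 1"
      using elim by auto
    ultimately show ?case
      using Fcoeff_symmetrized[of a b] by (simp add: t_def numeral_eq_Suc mult.commute)
  qed
  moreover have "(\<lambda>n. - (of_nat ((n + 1) choose Suc (a + b + 2)) * (1 - unit_root n) ^ (a + b + 2) / of_nat n))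
      \<longlonglongrightarrow> - ((- 2 * of_real pi * \<i>) ^ (a + b + 2) / fact (Suc (a + b + 2)))"
    by (intro tendsto_minus binomial_one_minus_root_tendsto)
  ultimately have "(\<lambda>n. zn n (replicate a 1 @ [2] @ replicate b 1) (unit_root n) +
        zn n (replicate b 1 @ [2] @ replicate a 1) (unit_root n))
      \<longlonglongrightarrow> - ((- 2 * of_real pi * \<i>) ^ (a + b + 2) / fact (Suc (a + b + 2)))"
    by (rule Lim_transform_eventually[rotated])
  moreover have "(\<lambda>n. zn n (replicate a 1 @ [2] @ replicate b 1) (unit_root n) +
        zn n (replicate b 1 @ [2] @ replicate a 1) (unit_root n))
      \<longlonglongrightarrow> xi (replicate a 1 @ [2] @ replicate b 1) + xi (replicate b 1 @ [2] @ replicate a 1)"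
    by (intro tendsto_add zn_tendsto_xi) auto
  ultimately have "xi (replicate a 1 @ [2] @ replicate b 1) + xi (replicate b 1 @ [2] @ replicate a 1)
      = - ((- 2 * of_real pi * \<i>) ^ (a + b + 2) / fact (Suc (a + b + 2)))"
    by (rule LIMSEQ_unique[rotated])
  moreover have "Suc (a + b + 2) = a + b + 3"
    by simp
  ultimately show "xi (replicate a 1 @ [2] @ replicate b 1) + xi (replicate b 1 @ [2] @ replicate a 1)
      = - ((- 2 * of_real pi * \<i>) ^ (a + b + 2) / fact (a + b + 3))"
    by (simp only:)
next
  \<comment> \<open>The convergent cofactor of \<open>- t\<close> in
    \<open>mid_sum_3_symmetrized\<close>; since \<open>t\<close> tends to 0, so does the symmetrized
    sum.\<close>
  define M where "M = (\<lambda>n. \<Sum>k\<in>{1..<n}. esym (zn_weight (unit_root n) 2) {1..<k} b *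
      zn_weight (unit_root n) 2 k * esym (zn_weight (unit_root n) 2) {Suc k..<n} a)"
  have "convergent M"
    unfolding M_def using convergent_esym_2_root by (intro convergent_mid_sum_root) auto
  then have "(\<lambda>n. - (1 - unit_root n) * M n) \<longlonglongrightarrow> - (1 - 1) * lim M"
    by (intro tendsto_intros unit_root_tendsto) (simp add: convergent_LIMSEQ_iff)
  moreover have "\<forall>\<^sub>F n in sequentially. - (1 - unit_root n) * M n =
      zn n (replicate a 2 @ [3] @ replicate b 2) (unit_root n) + zn n (replicate b 2 @ [3] @ replicate a 2) (unit_root n)"
    using eventually_ge_at_top[of 2]
  proof eventually_elim
    case (elim n)
    interpret primitive_root n "unit_root n"
      using elim by (rule primitive_root_unit_root)
    show ?case
      unfolding zn_replicate_mid mid_sum_3_symmetrized M_def t_def ..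
  qed
  ultimately have "(\<lambda>n. zn n (replicate a 2 @ [3] @ replicate b 2) (unit_root n) +
      zn n (replicate b 2 @ [3] @ replicate a 2) (unit_root n)) \<longlonglongrightarrow> - (1 - 1) * lim M"
    by (rule Lim_transform_eventually)
  moreover have "(\<lambda>n. zn n (replicate a 2 @ [3] @ replicate b 2) (unit_root n) +
        zn n (replicate b 2 @ [3] @ replicate a 2) (unit_root n))
      \<longlonglongrightarrow> xi (replicate a 2 @ [3] @ replicate b 2) + xi (replicate b 2 @ [3] @ replicate a 2)"
    by (intro tendsto_add zn_tendsto_xi) auto
  ultimately show "xi (replicate a 2 @ [3] @ replicate b 2) + xi (replicate b 2 @ [3] @ replicate a 2) = 0"
    by (auto dest: LIMSEQ_unique)
qed

end
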